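(* Let $n\ge1$. For every $k\in\{1,\dots,n\}$, a basis of $\mathcal J^{2n+1-k}$ is provided by the elements of the form $dx_I\wedge dy_J\wedge\alpha_R\wedge\theta$, where $(I,J,R)$ ranges among those triples such that - $I\subset\{1,\dots,n\}$, $J\subset\{1,\dots,n\}$, $|I|+|J|\le k$ and $I\cap J=\emptyset$; - $R$ is a standard Young tableau containing the elements of $\{1,\dots,n\}\setminus(I\cup J)$ arranged in two rows of length, respectively, $(2n-k-|I|-|J|)/2$ and $(k-|I|-|J|)/2$ (in particular $|I|+|J|\equiv k$ mod $2$).
   Context: On $\mathbb R^{2n+1}$ with coordinates $(x,y,t)\in\mathbb R^n\times\mathbb R^n\times\mathbb R$ let $\theta=dt+\frac12\sum_{j=1}^n(y_jdx_j-x_jdy_j)$, so that $d\theta=-\sum_{j=1}^ndx_j\wedge dy_j$. $\mathfrak h$ is the Heisenberg Lie algebra, and $\bigwedge^m\mathfrak h$ is the $m$-th exterior power of the $(2n+1)$-dimensional space with basis $dx_1,\dots,dx_n,dy_1,\dots,dy_n,\theta$ (with $d\theta$ regarded as the element $-\sum_jdx_j\wedge dy_j$ of $\bigwedge^2\mathfrak h$). Define $\mathcal J^m:=\{\lambda\in\bigwedge^m\mathfrak h:\lambda\wedge\theta=0\text{ and }\lambda\wedge d\theta=0\}$. For $I=\{i_1<\dots<i_{|I|}\}\subset\{1,\dots,n\}$, $dx_I:=dx_{i_1}\wedge\dots\wedge dx_{i_{|I|}}$, $dy_I:=dy_{i_1}\wedge\dots\wedge dy_{i_{|I|}}$ (equal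 to $1$ if $I=\emptyset$); $dxy_i:=dx_i\wedge dy_i$. A (two-row) Young tableau $R$ containing the elements of a finite set $M\subset\mathbb N$, $|M|=m$, is an arrangement of the elements of $M$ (each appearing exactly once) in a first row $R^1_1,\dots,R^1_\ell$ and a second row $R^2_1,\dots,R^2_{m-\ell}$, left-justified, with $\ell\ge m/2$ (the second row may be empty; $R$ is empty if $m=0$). It is standard if $R^i_j<R^i_{j+1}$ and $R^1_j<R^2_j$ whenever these entries exist. One sets $$\alpha_R:=(dxy_{R^1_1}-dxy_{R^2_1})\wedge\dots\wedge(dxy_{R^1_{m-\ell}}-dxy_{R^2_{m-\ell}})\wedge dxy_{R^1_{m-\ell+1}}\wedge\dots\wedge dxy_{R^1_\ell},$$ with $\alpha_R=1$ for the empty tableau and $\alpha_R=dxy_{R^1_1}\wedge\dots\wedge dxy_{R^1_\ell}$ if the second row is empty. *)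

theory Defs
  imports "HOL-Analysis.Analysis"
begin

section \<open>The real exterior algebra on a linearly ordered set of generators\<close>

text \<open>
  The exterior algebra of the real vector space with basis \<^typ>\<open>'a\<close>. An element is stored by its
  coefficients with respect to the monomials
  \<open>a\<^sub>1 \<and> \<dots> \<and> a\<^sub>m\<close> with \<open>a\<^sub>1 < \<dots> < a\<^sub>m\<close>, each of which is identified with the finite set
  \<open>{a\<^sub>1, \<dots>, a\<^sub>m}\<close>. The wedge product is the multiplication \<open>*\<close> of the algebra.
\<close>

typedef 'a grassmann =
  "{f :: 'a set \<Rightarrow> real. finite {S. f S \<noteq> 0} \<and> (\<forall>S. f S \<noteq> 0 \<longrightarrow> finite S)}"
  morphisms gcoeff Abs_grassmann
  by (rule exI[of _ "\<lambda>_. 0"]) simp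

setup_lifting type_definition_grassmann

lemma finite_gcoeff: "finite {S. gcoeff f S \<noteq> 0}"
  and gcoeff_infinite: "infinite S \<Longrightarrow> gcoeff f S = 0"
  using gcoeff[of f] by auto

lemma grassmann_eqI: "(\<And>S. finite S \<Longrightarrow> gcoeff f S = gcoeff g S) \<Longrightarrow> f = g"
  by (metis ext gcoeff_infinite gcoeff_inject)

text \<open>
  The sign of the permutation sorting the concatenation of the increasing enumerations of the
  disjoint finite sets \<open>A\<close> and \<open>B\<close>.
\<close>

definition shuffle_sgn :: "'a::linorder set \<Rightarrow> 'a set \<Rightarrow> real"
  where "shuffle_sgn A B = (- 1) ^ card {(a, b). a \<in> A \<and> b \<in> B \<and> b < a}"

lemma finite_inversions:
  "finite A \<Longrightarrow> finite B \<Longrightarrow> finite {(a, b). a \<in> A \<and> b \<in> B \<and> b < (a::'a::linorder)}"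
  by (rule finite_subset[of _ "A \<times> B"]) auto

lemma shuffle_sgn_empty [simp]: "shuffle_sgn {} B = 1" "shuffle_sgn A {} = 1"
  by (simp_all add: shuffle_sgn_def)

lemma shuffle_sgn_Un_left:
  assumes "finite A" "finite B" "finite C" "A \<inter> B = {}"
  shows "shuffle_sgn (A \<union> B) C = shuffle_sgn A C * shuffle_sgn B C"
proof -
  have "{(a, b). a \<in> A \<union> B \<and> b \<in> C \<and> b < a} =
        {(a, b). a \<in> A \<and> b \<in> C \<and> b < a} \<union> {(a, b). a \<in> B \<and> b \<in> C \<and> b < a}"
    by auto
  moreover have "{(a, b). a \<in> A \<and> b \<in> C \<and> b < a} \<inter> {(a, b). a \<in> B \<and> b \<in> C \<and> b < a} = {}"
    using assms(4) by auto
  ultimately show ?thesis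
    unfolding shuffle_sgn_def
    by (simp add: card_Un_disjoint finite_inversions assms power_add)
qed

lemma shuffle_sgn_Un_right:
  assumes "finite A" "finite B" "finite C" "B \<inter> C = {}"
  shows "shuffle_sgn A (B \<union> C) = shuffle_sgn A B * shuffle_sgn A C"
proof -
  have "{(a, b). a \<in> A \<and> b \<in> B \<union> C \<and> b < a} =
        {(a, b). a \<in> A \<and> b \<in> B \<and> b < a} \<union> {(a, b). a \<in> A \<and> b \<in> C \<and> b < a}"
    by auto
  moreover have "{(a, b). a \<in> A \<and> b \<in> B \<and> b < a} \<inter> {(a, b). a \<in> A \<and> b \<in> C \<and> b < a} = {}"
    using assms(4) by auto
  ultimately show ?thesis
    unfolding shuffle_sgn_def
    by (simp add: card_Un_disjoint finite_inversions assms power_add)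
qed

instantiation grassmann :: (type) real_vector
begin

lift_definition zero_grassmann :: "'a grassmann" is "\<lambda>_. 0"
  by simp

lift_definition plus_grassmann :: "'a grassmann \<Rightarrow> 'a grassmann \<Rightarrow> 'a grassmann"
  is "\<lambda>f g S. f S + g S"
proof -
  fix f g :: "'a set \<Rightarrow> real"
  assume a: "finite {S. f S \<noteq> 0} \<and> (\<forall>S. f S \<noteq> 0 \<longrightarrow> finite S)"
    and b: "finite {S. g S \<noteq> 0} \<and> (\<forall>S. g S \<noteq> 0 \<longrightarrow> finite S)"
  have "{S. f S + g S \<noteq> 0} \<subseteq> {S. f S \<noteq> 0} \<union> {S. g S \<noteq> 0}" by auto
  with a b have "finite {S. f S + g S \<noteq> 0}" by (meson finite_UnI finite_subset)
  moreover have "finite S" if "f S + g S \<noteq> 0" for S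
    using that a b by (cases "f S = 0") auto
  ultimately show "finite {S. f S + g S \<noteq> 0} \<and> (\<forall>S. f S + g S \<noteq> 0 \<longrightarrow> finite S)"
    by blast
qed

lift_definition uminus_grassmann :: "'a grassmann \<Rightarrow> 'a grassmann" is "\<lambda>f S. - f S"
  by simp

definition minus_grassmann :: "'a grassmann \<Rightarrow> 'a grassmann \<Rightarrow> 'a grassmann"
  where "minus_grassmann f g = f + (- g)"

lift_definition scaleR_grassmann :: "real \<Rightarrow> 'a grassmann \<Rightarrow> 'a grassmann"
  is "\<lambda>c f S. c * f S"
  by (auto elim: rev_finite_subset)

instance
proof
  fix f g h :: "'a grassmann" and c d :: real
  show "f - g = f + - g" by (rule minus_grassmann_def)
qed (rule grassmann_eqI; simp add: zero_grassmann.rep_eq plus_grassmann.rep_eq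
      uminus_grassmann.rep_eq minus_grassmann_def scaleR_grassmann.rep_eq algebra_simps)+

end

instantiation grassmann :: (linorder) real_algebra_1
begin

lift_definition one_grassmann :: "'a grassmann" is "\<lambda>S. if S = {} then 1 else 0"
  by auto

lift_definition times_grassmann :: "'a grassmann \<Rightarrow> 'a grassmann \<Rightarrow> 'a grassmann"
  is "\<lambda>f g S. \<Sum>A\<in>Pow S. shuffle_sgn A (S - A) * f A * g (S - A)"
proof -
  fix f g :: "'a set \<Rightarrow> real"
  assume a: "finite {S. f S \<noteq> 0} \<and> (\<forall>S. f S \<noteq> 0 \<longrightarrow> finite S)"
    and b: "finite {S. g S \<noteq> 0} \<and> (\<forall>S. g S \<noteq> 0 \<longrightarrow> finite S)"
  let ?p = "\<lambda>S. \<Sum>A\<in>Pow S. shuffle_sgn A (S - A) * f A * g (S - A)"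
  have fin: "S \<in> (\<lambda>(A, B). A \<union> B) ` ({S. f S \<noteq> 0} \<times> {S. g S \<noteq> 0}) \<and> finite S"
    if "?p S \<noteq> 0" for S
  proof -
    from that obtain A where A: "A \<in> Pow S" "shuffle_sgn A (S - A) * f A * g (S - A) \<noteq> 0"
      by (rule sum.not_neutral_contains_not_neutral)
    then have S: "S = (\<lambda>(A, B). A \<union> B) (A, S - A)" and nz: "f A \<noteq> 0" "g (S - A) \<noteq> 0" by auto
    from nz a b have "finite A" "finite (S - A)" by blast+
    then have "finite S" using finite_Diff2 by blast
    moreover from nz have "(A, S - A) \<in> {S. f S \<noteq> 0} \<times> {S. g S \<noteq> 0}" by simp
    ultimately show ?thesis using S by blast
  qed
  have "finite ((\<lambda>(A, B). A \<union> B) ` ({S. f S \<noteq> 0} \<times> {S. g S \<noteq> 0}))"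
    using a b by blast
  then have "finite {S. ?p S \<noteq> 0}" by (rule rev_finite_subset) (use fin in auto)
  with fin show "finite {S. ?p S \<noteq> 0} \<and> (\<forall>S. ?p S \<noteq> 0 \<longrightarrow> finite S)" by blast
qed

instance
proof
  fix f g h :: "'a grassmann" and c :: real
  show "f * g * h = f * (g * h)"
  proof (rule grassmann_eqI)
    fix S :: "'a set" assume S: "finite S"
    have fs: "finite A" if "A \<subseteq> S" for A using S that finite_subset by blast
    let ?F = "\<lambda>(A, B). shuffle_sgn A B * shuffle_sgn A (S - A - B) * shuffle_sgn B (S - A - B)
                * gcoeff f A * gcoeff g B * gcoeff h (S - A - B)"
    have "gcoeff (f * g * h) S =
        (\<Sum>A\<in>Pow S. \<Sum>B\<in>Pow A. shuffle_sgn A (S - A) * shuffle_sgn B (A - B) *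
            gcoeff f B * gcoeff g (A - B) * gcoeff h (S - A))"
      by (simp add: times_grassmann.rep_eq sum_distrib_left sum_distrib_right mult.assoc)
    also have "\<dots> = (\<Sum>(A, B)\<in>(SIGMA A:Pow S. Pow A). shuffle_sgn A (S - A) * shuffle_sgn B (A - B) *
            gcoeff f B * gcoeff g (A - B) * gcoeff h (S - A))"
      using S fs by (subst sum.Sigma) auto
    also have "\<dots> = (\<Sum>p\<in>(SIGMA A:Pow S. Pow (S - A)). ?F p)"
    proof (rule sum.reindex_bij_witness[where i = "\<lambda>(A, B). (A \<union> B, A)" and j = "\<lambda>(A, B). (B, A - B)"],
           goal_cases)
      case (5 p)
      then obtain A B where p: "p = (A, B)" and AB: "A \<subseteq> S" "B \<subseteq> A" by auto
      have *: "shuffle_sgn A (S - A) = shuffle_sgn B (S - A) * shuffle_sgn (A - B) (S - A)"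
        using shuffle_sgn_Un_left[of B "A - B" "S - A"] fs AB
        by (metis Diff_disjoint Diff_partition Diff_subset order_trans)
      have **: "S - B - (A - B) = S - A" using AB by auto
      show ?case unfolding p by (simp add: * **)
    qed auto
    also have "\<dots> = (\<Sum>A\<in>Pow S. \<Sum>B\<in>Pow (S - A). ?F (A, B))"
      using S fs by (subst sum.Sigma) auto
    also have "\<dots> = (\<Sum>A\<in>Pow S. \<Sum>B\<in>Pow (S - A). shuffle_sgn A (S - A) * gcoeff f A *
        (shuffle_sgn B (S - A - B) * gcoeff g B * gcoeff h (S - A - B)))"
    proof (intro sum.cong refl)
      fix A B assume AB: "A \<in> Pow S" "B \<in> Pow (S - A)"
      have "B \<union> (S - A - B) = S - A" using AB by auto
      then have "shuffle_sgn A (S - A) = shuffle_sgn A B * shuffle_sgn A (S - A - B)"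
        using shuffle_sgn_Un_right[of A B "S - A - B"] fs AB
        by (metis Diff_disjoint Diff_subset PowD order_trans)
      then show "?F (A, B) = shuffle_sgn A (S - A) * gcoeff f A *
        (shuffle_sgn B (S - A - B) * gcoeff g B * gcoeff h (S - A - B))" by simp
    qed
    also have "\<dots> = gcoeff (f * (g * h)) S"
      by (simp add: times_grassmann.rep_eq sum_distrib_left)
    finally show "gcoeff (f * g * h) S = gcoeff (f * (g * h)) S" .
  qed
  show "1 * f = f"
  proof (rule grassmann_eqI)
    fix S :: "'a set" assume S: "finite S"
    have "gcoeff (1 * f) S = (\<Sum>A\<in>Pow S. if A = {} then gcoeff f S else 0)"
      unfolding times_grassmann.rep_eq one_grassmann.rep_eq by (intro sum.cong) auto
    then show "gcoeff (1 * f) S = gcoeff f S" using S by simp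
  qed
  show "f * 1 = f"
  proof (rule grassmann_eqI)
    fix S :: "'a set" assume S: "finite S"
    have "gcoeff (f * 1) S = (\<Sum>A\<in>Pow S. if A = S then gcoeff f S else 0)"
      unfolding times_grassmann.rep_eq one_grassmann.rep_eq by (intro sum.cong) auto
    then show "gcoeff (f * 1) S = gcoeff f S" using S by simp
  qed
  show "(f + g) * h = f * h + g * h" "f * (g + h) = f * g + f * h"
    "c *\<^sub>R f * g = c *\<^sub>R (f * g)" "f * c *\<^sub>R g = c *\<^sub>R (f * g)"
    by (rule grassmann_eqI; simp add: times_grassmann.rep_eq plus_grassmann.rep_eq
        scaleR_grassmann.rep_eq algebra_simps sum.distrib sum_distrib_left)+
  show "(0 :: 'a grassmann) \<noteq> 1"
  proof
    assume "(0 :: 'a grassmann) = 1"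
    then have "gcoeff (0 :: 'a grassmann) {} = gcoeff 1 {}" by simp
    then show False by (simp add: zero_grassmann.rep_eq one_grassmann.rep_eq)
  qed
qed

end

lift_definition gmonom :: "'a set \<Rightarrow> 'a grassmann"
  is "\<lambda>S T. if T = S \<and> finite S then 1 else 0"
  by auto

definition gen :: "'a \<Rightarrow> 'a grassmann"
  where "gen a = gmonom {a}"

text \<open>
  The following facts characterise the exterior algebra: the generators satisfy the defining
  relations, and their increasing products are linearly independent and span.
\<close>

lemma gmonom_mult:
  assumes "finite A" "finite B"
  shows "gmonom A * gmonom B = (if A \<inter> B = {} then shuffle_sgn A B *\<^sub>R gmonom (A \<union> B) else 0)"
proof (rule grassmann_eqI)
  fix S :: "'a set" assume S: "finite S"
  have "gcoeff (gmonom A * gmonom B) S =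
      (\<Sum>C\<in>Pow S. if C = A then (if S - A = B then shuffle_sgn A B else 0) else 0)"
    unfolding times_grassmann.rep_eq gmonom.rep_eq using assms by (intro sum.cong) auto
  also have "\<dots> = (if A \<subseteq> S \<and> S - A = B then shuffle_sgn A B else 0)"
    using S by simp
  also have "\<dots> = gcoeff (if A \<inter> B = {} then shuffle_sgn A B *\<^sub>R gmonom (A \<union> B) else 0) S"
  proof -
    have "A \<subseteq> S \<and> S - A = B \<longleftrightarrow> A \<inter> B = {} \<and> S = A \<union> B" by auto
    then show ?thesis
      using assms by (simp add: scaleR_grassmann.rep_eq zero_grassmann.rep_eq gmonom.rep_eq)
  qed
  finally show "gcoeff (gmonom A * gmonom B) S =
    gcoeff (if A \<inter> B = {} then shuffle_sgn A B *\<^sub>R gmonom (A \<union> B) else 0) S" .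
qed

lemma gmonom_empty: "gmonom {} = 1"
  by transfer auto

lemma gen_square: "gen a * gen a = 0"
  by (simp add: gen_def gmonom_mult)

lemma gen_anticommute: "gen a * gen b = - (gen b * gen a)"
proof (cases "a = b")
  case False
  have inv: "{(x, y). x \<in> {c} \<and> y \<in> {d} \<and> y < x} = (if d < c then {(c, d)} else {})"
    for c d :: 'a by auto
  have "shuffle_sgn {a} {b} = - shuffle_sgn {b} {a}"
    unfolding shuffle_sgn_def inv using False by auto
  with False show ?thesis by (simp add: gen_def gmonom_mult insert_commute)
qed (simp add: gen_square)

lemma gmonom_eq_prod_list:
  assumes "sorted_wrt (<) as"
  shows "gmonom (set as) = prod_list (map gen as)"
  using assms
proof (induction as)
  case (Cons a as)
  have "{(x, y). x \<in> {a} \<and> y \<in> set as \<and> y < x} = {}" using Cons.prems by fastforce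
  then have "shuffle_sgn {a} (set as) = 1" unfolding shuffle_sgn_def by (metis card.empty power_0)
  moreover have "{a} \<inter> set as = {}" using Cons.prems by auto
  ultimately have "gmonom (set (a # as)) = gen a * gmonom (set as)"
    by (simp add: gen_def gmonom_mult)
  then show ?case using Cons by simp
qed (simp add: gmonom_empty)

lemma gcoeff_sum: "gcoeff (sum f X) S = (\<Sum>x\<in>X. gcoeff (f x) S)"
  by (induction X rule: infinite_finite_induct)
     (simp_all add: zero_grassmann.rep_eq plus_grassmann.rep_eq)

lemma inj_on_gmonom: "inj_on gmonom {S. finite S}"
proof (rule inj_onI)
  fix S T :: "'a set" assume "S \<in> {S. finite S}" "gmonom S = gmonom T"
  then have "gcoeff (gmonom T) S = 1" by (metis gmonom.rep_eq mem_Collect_eq)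
  then show "S = T" by (simp add: gmonom.rep_eq split: if_splits)
qed

lemma span_gmonom: "span (gmonom ` {S. finite S}) = UNIV"
proof -
  have "f \<in> span (gmonom ` {S. finite S})" for f :: "'a grassmann"
  proof -
    have "f = (\<Sum>S\<in>{S. gcoeff f S \<noteq> 0}. gcoeff f S *\<^sub>R gmonom S)"
    proof (rule grassmann_eqI)
      fix T :: "'a set" assume T: "finite T"
      have "gcoeff (\<Sum>S\<in>{S. gcoeff f S \<noteq> 0}. gcoeff f S *\<^sub>R gmonom S) T =
          (\<Sum>S\<in>{S. gcoeff f S \<noteq> 0}. if S = T then gcoeff f T else 0)"
        unfolding gcoeff_sum scaleR_grassmann.rep_eq gmonom.rep_eq using T by (intro sum.cong) auto
      then show "gcoeff f T = gcoeff (\<Sum>S\<in>{S. gcoeff f S \<noteq> 0}. gcoeff f S *\<^sub>R gmonom S) T"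
        by (simp add: finite_gcoeff)
    qed
    also have "\<dots> \<in> span (gmonom ` {S. finite S})"
      using gcoeff_infinite by (intro span_sum span_scale span_base) blast
    finally show ?thesis .
  qed
  then show ?thesis by blast
qed

lemma independent_gmonom: "independent (gmonom ` {S :: 'a set. finite S})"
proof
  assume "dependent (gmonom ` {S :: 'a set. finite S})"
  then obtain X u v where X: "finite X" "X \<subseteq> gmonom ` {S :: 'a set. finite S}"
    and 0: "(\<Sum>w\<in>X. u w *\<^sub>R w) = 0" and v: "v \<in> X" "u v \<noteq> 0"
    unfolding dependent_explicit by blast
  from X v obtain S where S: "finite S" "v = gmonom S" by blast
  have "gcoeff (u w *\<^sub>R w) S = (if w = v then u v else 0)" if "w \<in> X" for w
  proof -
    from that X obtain T where "finite T" "w = gmonom T" by blast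
    with S show ?thesis
      using inj_on_gmonom by (auto simp: scaleR_grassmann.rep_eq gmonom.rep_eq inj_on_def)
  qed
  then have "gcoeff (\<Sum>w\<in>X. u w *\<^sub>R w) S = (\<Sum>w\<in>X. if w = v then u v else 0)"
    unfolding gcoeff_sum by (rule sum.cong[OF refl])
  with X v 0 show False by (simp add: zero_grassmann.rep_eq)
qed

section \<open>Left-invariant forms on the Heisenberg group\<close>

text \<open>
  \<open>DX i\<close>, \<open>DY i\<close> and \<open>Theta\<close> label the basis \<open>dx\<^sub>i, dy\<^sub>i, \<theta>\<close>; the order on
  the labels only fixes the internal sign convention of \<^typ>\<open>'a grassmann\<close>.
\<close>

datatype heis_label = DX nat | DY nat | Theta

fun label_key :: "heis_label \<Rightarrow> nat" where
  "label_key Theta = 0"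
| "label_key (DX i) = 2 * i + 1"
| "label_key (DY i) = 2 * i + 2"

lemma label_key_inj: "label_key a = label_key b \<Longrightarrow> a = b"
  by (cases a; cases b; simp) presburger+

instantiation heis_label :: linorder
begin

definition less_eq_heis_label :: "heis_label \<Rightarrow> heis_label \<Rightarrow> bool"
  where "a \<le> b \<longleftrightarrow> label_key a \<le> label_key b"

definition less_heis_label :: "heis_label \<Rightarrow> heis_label \<Rightarrow> bool"
  where "a < b \<longleftrightarrow> label_key a < label_key b"

instance
  by standard (auto simp: less_eq_heis_label_def less_heis_label_def label_key_inj)

end

type_synonym heis_form = "heis_label grassmann"

definition dx :: "nat \<Rightarrow> heis_form" where "dx i = gen (DX i)"

definition dy :: "nat \<Rightarrow> heis_form" where "dy i = gen (DY i)"

definition theta :: heis_form where "theta = gen Theta"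

definition dtheta :: "nat \<Rightarrow> heis_form"
  where "dtheta n = - (\<Sum>j = 1..n. dx j * dy j)"

definition heis_covectors :: "nat \<Rightarrow> heis_form set"
  where "heis_covectors n = span (dx ` {1..n} \<union> dy ` {1..n} \<union> {theta})"

text \<open>The \<open>m\<close>-th exterior power: the span of all wedge products of \<open>m\<close> covectors.\<close>

definition ext_power :: "nat \<Rightarrow> nat \<Rightarrow> heis_form set"
  where "ext_power n m =
    span {prod_list vs | vs. length vs = m \<and> set vs \<subseteq> heis_covectors n}"

definition J_space :: "nat \<Rightarrow> nat \<Rightarrow> heis_form set"
  where "J_space n m = {l \<in> ext_power n m. l * theta = 0 \<and> l * dtheta n = 0}"

definition dx_set :: "nat set \<Rightarrow> heis_form"
  where "dx_set I = prod_list (map dx (sorted_list_of_set I))"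

definition dy_set :: "nat set \<Rightarrow> heis_form"
  where "dy_set I = prod_list (map dy (sorted_list_of_set I))"

definition dxy :: "nat \<Rightarrow> heis_form"
  where "dxy i = dx i * dy i"

section \<open>Two-row Young tableaux\<close>

text \<open>A tableau is the pair of its rows; the entries of a row are listed from left to right.\<close>

type_synonym tableau = "nat list \<times> nat list"

definition young_tableau :: "nat set \<Rightarrow> tableau \<Rightarrow> bool"
  where "young_tableau M R \<longleftrightarrow>
    distinct (fst R @ snd R) \<and> set (fst R @ snd R) = M \<and> length (snd R) \<le> length (fst R)"

definition standard_tableau :: "tableau \<Rightarrow> bool"
  where "standard_tableau R \<longleftrightarrow>
    sorted_wrt (<) (fst R) \<and> sorted_wrt (<) (snd R) \<and>
    (\<forall>j < length (snd R). fst R ! j < snd R ! j)"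

definition alpha :: "tableau \<Rightarrow> heis_form"
  where "alpha R =
    prod_list (map (\<lambda>j. dxy (fst R ! j) - dxy (snd R ! j)) [0..<length (snd R)]) *
    prod_list (map (\<lambda>j. dxy (fst R ! j)) [length (snd R)..<length (fst R)])"

definition J_index :: "nat \<Rightarrow> nat \<Rightarrow> (nat set \<times> nat set \<times> tableau) set"
  where "J_index n k = {(I, J, R).
    I \<subseteq> {1..n} \<and> J \<subseteq> {1..n} \<and> card I + card J \<le> k \<and> I \<inter> J = {} \<and>
    young_tableau ({1..n} - (I \<union> J)) R \<and> standard_tableau R \<and>
    real (length (fst R)) = (2 * real n - real k - real (card I) - real (card J)) / 2 \<and>
    real (length (snd R)) = (real k - real (card I) - real (card J)) / 2}"

definition J_element :: "nat set \<times> nat set \<times> tableau \<Rightarrow> heis_form"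
  where "J_element = (\<lambda>(I, J, R). dx_set I * dy_set J * alpha R * theta)"

end

theory Submission
  imports Defs
begin

text \<open>
  A horizontal form \<open>\<beta>\<close> splits according to the sets \<open>I\<close> and \<open>J\<close> of indices that occur only through
  \<open>dx\<close> and only through \<open>dy\<close>; on each piece \<open>\<beta>\<close> is a function \<open>f\<close> on the subsets \<open>K\<close>, of a fixed size
  \<open>s\<close>, of \<open>M = {1..n} - (I \<union> J)\<close>, and wedging with \<open>d\<theta>\<close> is minus the raising operator of the Boolean
  lattice of \<open>M\<close>. The monomial of \<open>\<alpha>\<^sub>R\<close> with the smallest sum of indices is given by the first row
  of \<open>R\<close>, which determines \<open>R\<close>; so the \<open>\<alpha>\<^sub>R\<close> are independent and any \<open>f\<close> can be modified by them until
  it vanishes on all first rows of standard tableaux, i.e. on all ballot subsets. An element of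
  the kernel of the raising operator that vanishes on all ballot subsets is zero, by induction on \<open>M\<close>.
\<close>

section \<open>Triangular families of vectors\<close>

text \<open>The matrix of the values \<open>\<phi> j (e i)\<close> is triangular for the weight
  \<open>w\<close> with nonzero diagonal, so Gaussian elimination applies. The third conclusion
  reduces any vector modulo the span until all functionals kill the remainder; that the remainder is
  zero has to come from elsewhere.\<close>

lemma
  fixes e :: "'i \<Rightarrow> 'v::real_vector" and \<phi> :: "'i \<Rightarrow> 'v \<Rightarrow> real" and w :: "'i \<Rightarrow> nat"
  assumes fin: "finite X" and lin: "\<And>i. i \<in> X \<Longrightarrow> linear (\<phi> i)"
    and diag: "\<And>i. i \<in> X \<Longrightarrow> \<phi> i (e i) \<noteq> 0"
    and tri: "\<And>i j. i \<in> X \<Longrightarrow> j \<in> X \<Longrightarrow> i \<noteq> j \<Longrightarrow> \<phi> j (e i) \<noteq> 0 \<Longrightarrow> w i < w j"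
  shows inj_on_triangular: "inj_on e X"
    and independent_triangular: "independent (e ` X)"
    and ex_span_triangular: "\<exists>u\<in>span (e ` X). \<forall>i\<in>X. \<phi> i (v - u) = 0"
proof -
  show inj: "inj_on e X"
  proof (rule inj_onI, rule ccontr)
    fix i j assume *: "i \<in> X" "j \<in> X" "e i = e j" "i \<noteq> j"
    have "w i < w j" using tri[of i j] diag[of j] * by auto
    moreover have "w j < w i" using tri[of j i] diag[of i] * by auto
    ultimately show False by simp
  qed
  show "independent (e ` X)"
  proof
    assume "dependent (e ` X)"
    then obtain u where u: "\<exists>v\<in>e ` X. u v \<noteq> 0" "(\<Sum>v\<in>e ` X. u v *\<^sub>R v) = 0"
      using dependent_finite[of "e ` X"] fin by auto
    define Z where "Z = {i \<in> X. u (e i) \<noteq> 0}"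
    have "finite Z" "Z \<noteq> {}" using u fin by (auto simp: Z_def)
    \<comment> \<open>At an index of least weight among the nonzero coefficients,
      \<open>\<phi> i\<close> sees only the term \<open>i\<close> of the relation.\<close>
    then obtain i where i: "i \<in> Z" "\<And>j. j \<in> Z \<Longrightarrow> w i \<le> w j"
      by (metis arg_min_least arg_min_if_finite(1))
    then have iX: "i \<in> X" "u (e i) \<noteq> 0" by (auto simp: Z_def)
    have "0 = \<phi> i (\<Sum>j\<in>X. u (e j) *\<^sub>R e j)"
      using u(2) linear_0[OF lin[OF iX(1)]] by (simp add: sum.reindex[OF inj])
    also have "\<dots> = (\<Sum>j\<in>X. u (e j) * \<phi> i (e j))"
      by (simp add: linear_sum[OF lin[OF iX(1)]] linear_scale[OF lin[OF iX(1)]])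
    also have "\<dots> = (\<Sum>j\<in>X. if j = i then u (e i) * \<phi> i (e i) else 0)"
    proof (rule sum.cong[OF refl])
      fix j assume "j \<in> X"
      show "u (e j) * \<phi> i (e j) = (if j = i then u (e i) * \<phi> i (e i) else 0)"
        using tri[of j i] iX(1) \<open>j \<in> X\<close> i(2)[of j] by (force simp: Z_def)
    qed
    also have "\<dots> = u (e i) * \<phi> i (e i)" using fin iX by simp
    finally show False using iX diag by simp
  qed
  \<comment> \<open>Elimination by increasing weight: a multiple of \<open>e i\<close> with
    \<open>w i = m\<close> affects, besides \<open>\<phi> i\<close>, only functionals of weight
    above \<open>m\<close>, so what was achieved below \<open>m\<close> persists.\<close>
  have "\<exists>u\<in>span (e ` X). \<forall>i\<in>X. w i < m \<longrightarrow> \<phi> i (v - u) = 0" for m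
  proof (induction m)
    case 0
    show ?case by (auto intro: span_zero)
  next
    case (Suc m)
    then obtain u where u: "u \<in> span (e ` X)" "\<And>i. i \<in> X \<Longrightarrow> w i < m \<Longrightarrow> \<phi> i (v - u) = 0"
      by blast
    define c where "c i = \<phi> i (v - u) / \<phi> i (e i)" for i
    define Y where "Y = {i \<in> X. w i = m}"
    have finY: "finite Y" using fin by (simp add: Y_def)
    define u' where "u' = u + (\<Sum>i\<in>Y. c i *\<^sub>R e i)"
    have "u' \<in> span (e ` X)"
      unfolding u'_def Y_def by (intro span_add u(1) span_sum span_scale span_base) auto
    moreover have "\<phi> j (v - u') = 0" if j: "j \<in> X" "w j < Suc m" for j
    proof -
      have "\<phi> j (v - u') = \<phi> j ((v - u) - (\<Sum>i\<in>Y. c i *\<^sub>R e i))"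
        by (simp add: u'_def algebra_simps)
      also have "\<dots> = \<phi> j (v - u) - (\<Sum>i\<in>Y. c i * \<phi> j (e i))"
        unfolding linear_diff[OF lin[OF j(1)], of "v - u"]
        by (simp add: linear_sum[OF lin[OF j(1)]] linear_scale[OF lin[OF j(1)]])
      also have "(\<Sum>i\<in>Y. c i * \<phi> j (e i)) = (\<Sum>i\<in>Y. if i = j then c j * \<phi> j (e j) else 0)"
      proof (rule sum.cong[OF refl])
        fix i assume "i \<in> Y"
        then show "c i * \<phi> j (e i) = (if i = j then c j * \<phi> j (e j) else 0)"
          using tri[of i j] j by (force simp: Y_def)
      qed
      also have "\<dots> = (if j \<in> Y then \<phi> j (v - u) else 0)"
        using finY diag[OF j(1)] by (simp add: c_def)
      also have "\<phi> j (v - u) - \<dots> = 0" using u(2)[OF j(1)] j by (auto simp: Y_def)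
      finally show ?thesis .
    qed
    ultimately show ?case by blast
  qed
  \<comment> \<open>The sum of all weights bounds each of them, so this stage covers all of
    \<open>X\<close>.\<close>
  from this[of "Suc (\<Sum>i\<in>X. w i)"]
  obtain u where u: "u \<in> span (e ` X)"
    "\<And>i. i \<in> X \<Longrightarrow> w i < Suc (\<Sum>i\<in>X. w i) \<Longrightarrow> \<phi> i (v - u) = 0" by blast
  have "w i < Suc (\<Sum>i\<in>X. w i)" if "i \<in> X" for i
    using member_le_sum[of i X w] that fin by simp
  with u show "\<exists>u\<in>span (e ` X). \<forall>i\<in>X. \<phi> i (v - u) = 0" by blast
qed

section \<open>The kernel of the raising operator\<close>

text \<open>For \<open>j = 1\<close> this is the ballot condition: every initial segment of
  \<open>M\<close> has at least as many elements in \<open>K\<close> as outside. Larger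
  \<open>j\<close> tolerates a deficit of up to \<open>j - 1\<close>.\<close>

definition ballot :: "nat \<Rightarrow> 'a::linorder set \<Rightarrow> 'a set \<Rightarrow> bool"
  where "ballot j M K \<longleftrightarrow> (\<forall>x. card {a \<in> M - K. a \<le> x} < card {a \<in> K. a \<le> x} + j)"

text \<open>Double counting: an \<open>s\<close>-subset of \<open>L\<close> avoids exactly
  \<open>card L - s\<close> elements \<open>a\<close> of \<open>L\<close>. If \<open>s\<close>
  exceeds \<open>card L\<close>, all the inner sums are empty.\<close>

lemma sum_subsets_remove:
  fixes f :: "'a set \<Rightarrow> real"
  assumes "finite L"
  shows "(\<Sum>a\<in>L. \<Sum>K | K \<subseteq> L - {a} \<and> card K = s. f K) =
    (real (card L) - real s) * (\<Sum>K | K \<subseteq> L \<and> card K = s. f K)"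
proof -
  have fin: "finite {K. K \<subseteq> L \<and> card K = s}" using assms by simp
  have "(\<Sum>a\<in>L. \<Sum>K | K \<subseteq> L - {a} \<and> card K = s. f K) =
      (\<Sum>a\<in>L. \<Sum>K | K \<in> {K. K \<subseteq> L \<and> card K = s} \<and> a \<notin> K. f K)"
    by (intro sum.cong refl arg_cong[where f = "sum f"]) auto
  also have "\<dots> = (\<Sum>K | K \<subseteq> L \<and> card K = s. \<Sum>a | a \<in> L \<and> a \<notin> K. f K)"
    by (rule sum.swap_restrict[OF assms fin])
  also have "\<dots> = (\<Sum>K | K \<subseteq> L \<and> card K = s. (real (card L) - real s) * f K)"
  proof (rule sum.cong[OF refl])
    fix K assume K: "K \<in> {K. K \<subseteq> L \<and> card K = s}"
    then have "{a. a \<in> L \<and> a \<notin> K} = L - K" by auto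
    moreover have "card (L - K) = card L - s" "s \<le> card L"
      using K assms by (auto simp: card_Diff_subset finite_subset card_mono)
    ultimately show "(\<Sum>a | a \<in> L \<and> a \<notin> K. f K) = (real (card L) - real s) * f K"
      by (simp add: of_nat_diff)
  qed
  finally show ?thesis by (simp add: sum_distrib_left)
qed

lemma sum_subsets_insert:
  fixes f :: "'a set \<Rightarrow> real"
  assumes "finite L" "x \<notin> L"
  shows "(\<Sum>K | K \<subseteq> insert x L \<and> card K = Suc s. f K) =
    (\<Sum>K | K \<subseteq> L \<and> card K = Suc s. f K) + (\<Sum>K | K \<subseteq> L \<and> card K = s. f (insert x K))"
proof -
  have fin: "finite K" if "K \<subseteq> L" for K using assms(1) that by (rule rev_finite_subset)
  have inj: "inj_on (insert x) {K. K \<subseteq> L \<and> card K = s}"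
    using assms(2) by (intro inj_onI) (metis (no_types, lifting) insert_ident mem_Collect_eq subsetD)
  have "{K. K \<subseteq> insert x L \<and> card K = Suc s} =
      {K. K \<subseteq> L \<and> card K = Suc s} \<union> insert x ` {K. K \<subseteq> L \<and> card K = s}" (is "?A = ?B \<union> ?C")
  proof (intro equalityI subsetI)
    fix K assume K: "K \<in> ?A"
    show "K \<in> ?B \<union> ?C"
    proof (cases "x \<in> K")
      case True
      then have "K = insert x (K - {x})" by auto
      moreover have "K - {x} \<subseteq> L" "card (K - {x}) = s" using K True by (auto simp: card_Diff_singleton)
      ultimately show ?thesis by blast
    qed (use K in auto)
  next
    fix K assume K: "K \<in> ?B \<union> ?C"
    have "card (insert x K') = Suc (card K')" if "K' \<subseteq> L" for K'
      using fin[OF that] that assms(2) by (subst card_insert_disjoint) auto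
    then show "K \<in> ?A" using K by auto
  qed
  moreover have "?B \<inter> ?C = {}" using assms(2) by auto
  ultimately show ?thesis
    using assms(1) by (simp add: sum.union_disjoint sum.reindex[OF inj])
qed

text \<open>
  Up to the factor \<open>j!\<close>, the first hypothesis says that \<open>f\<close>, regarded as a function on the
  \<open>s\<close>-subsets of \<open>M\<close>, is killed by the \<open>j\<close>-th power of the raising operator of the Boolean lattice.
  The exponent \<open>j\<close> has to vary for the induction on \<open>M\<close> to go through.
\<close>

lemma raising_kernel_ballot:
  fixes f :: "'a::linorder set \<Rightarrow> real"
  assumes "finite M"
    and "\<And>L. L \<subseteq> M \<Longrightarrow> card L = s + j \<Longrightarrow> (\<Sum>K | K \<subseteq> L \<and> card K = s. f K) = 0"
    and "\<And>K. K \<subseteq> M \<Longrightarrow> card K = s \<Longrightarrow> ballot j M K \<Longrightarrow> f K = 0"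
    and "K \<subseteq> M" "card K = s"
  shows "f K = 0"
  using assms
proof (induction M arbitrary: f s j K rule: finite_linorder_max_induct)
  case empty
  show ?case
  proof (cases j)
    case 0
    have "{K. K \<subseteq> {} \<and> card K = s} = {{} :: 'a set}" using empty.prems by auto
    then show ?thesis using empty.prems 0 by force
  qed (use empty.prems in \<open>auto simp: ballot_def\<close>)
next
  case (insert x M)
  note up = insert.prems(1) and bal = insert.prems(2)
  have xM: "x \<notin> M" using insert.hyps by auto
  have finK: "finite K" if "K \<subseteq> M" for K using insert.hyps(1) that by (rule rev_finite_subset)
  have lower: "{a \<in> insert x A. a \<le> y} = {a \<in> A. a \<le> y}" if "y < x" for A y
    using that by auto
  have full: "{a \<in> A. a \<le> y} = A" if "A \<subseteq> M" "x \<le> y" for A y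
    using that insert.hyps(2) by force
  \<comment> \<open>The hypothesis for \<open>insert x L\<close>, sorted by whether a subset
    contains \<open>x\<close>. Writing \<open>Suc (card K) = s\<close> instead of
    \<open>card K = s - 1\<close> makes the second sum empty for \<open>s = 0\<close>.\<close>
  have split: "(\<Sum>K | K \<subseteq> L \<and> card K = s. f K) +
      (\<Sum>K | K \<subseteq> L \<and> Suc (card K) = s. f (insert x K)) = 0"
    if "L \<subseteq> M" "Suc (card L) = s + j" for L
  proof (cases s)
    case 0
    have "card (insert x L) = s + j" using that finK[of L] xM by (subst card_insert_disjoint) auto
    moreover have "insert x L \<subseteq> insert x M" using that by auto
    ultimately have "(\<Sum>K | K \<subseteq> insert x L \<and> card K = 0. f K) = 0" using up 0 by auto
    moreover have "{K. K \<subseteq> N \<and> card K = 0} = {{}}" if "finite N" for N :: "'a set"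
      using that by (auto simp: card_0_eq finite_subset[OF _ that])
    ultimately show ?thesis using 0 finK[OF that(1)] by simp
  next
    case (Suc s')
    have "card (insert x L) = s + j" using that finK[of L] xM by (subst card_insert_disjoint) auto
    moreover have "insert x L \<subseteq> insert x M" using that by auto
    ultimately have "(\<Sum>K | K \<subseteq> insert x L \<and> card K = s. f K) = 0" by (rule up[rotated])
    then show ?thesis using sum_subsets_insert[of L x f s'] finK[OF that(1)] xM that(1) Suc by auto
  qed
  \<comment> \<open>From here on \<open>f\<close> is treated as two functions on subsets of
    \<open>M\<close>: \<open>f\<close> itself and \<open>\<lambda>K. f (insert x K)\<close>.\<close>
  have goal: ?case
    if g: "\<And>K. K \<subseteq> M \<Longrightarrow> card K = s \<Longrightarrow> f K = 0"
      and h: "\<And>K. K \<subseteq> M \<Longrightarrow> Suc (card K) = s \<Longrightarrow> f (insert x K) = 0"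
  proof (cases "x \<in> K")
    case True
    have "K - {x} \<subseteq> M" using insert.prems(3) by auto
    moreover have "Suc (card (K - {x})) = s"
      using True insert.prems finK[OF \<open>K - {x} \<subseteq> M\<close>] by (metis card.remove finite_Diff2 finite.emptyI finite_insert)
    ultimately show ?thesis using h True by (metis insert_Diff)
  qed (use g insert.prems in auto)
  show ?case
  \<comment> \<open>For an \<open>s\<close>-subset of \<open>insert x M\<close> this is the ballot
    inequality at \<open>x\<close>. If it holds, a ballot \<open>s\<close>-subset of
    \<open>M\<close> remains ballot in \<open>insert x M\<close>, and the induction hypothesis
    applies to \<open>f\<close> with \<open>s\<close> and \<open>j\<close> unchanged.\<close>
  proof (cases "Suc (card M) < 2 * s + j")
    case True
    have g: "f K = 0" if "K \<subseteq> M" "card K = s" for K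
    proof (rule insert.IH[of s j f])
      fix K assume K: "K \<subseteq> M" "card K = s" "ballot j M K"
      have "ballot j (insert x M) K" unfolding ballot_def
      proof
        fix y
        have eq: "insert x M - K = insert x (M - K)" using K xM by auto
        show "card {a \<in> insert x M - K. a \<le> y} < card {a \<in> K. a \<le> y} + j"
        proof (cases "y < x")
          case True
          then show ?thesis using K(3) unfolding eq lower[OF True] by (simp add: ballot_def)
        next
          case False
          have "card {a \<in> insert x M - K. a \<le> y} \<le> card (insert x (M - K))"
            unfolding eq using insert.hyps(1) by (intro card_mono) auto
          also have "\<dots> = Suc (card M - s)"
            using K xM insert.hyps(1) finK[OF K(1)] by (simp add: card_Diff_subset)
          also have "\<dots> < s + j"
            using True card_mono[OF insert.hyps(1) K(1)] K(2) by simp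
          finally show ?thesis using full[of K y] K False by simp
        qed
      qed
      then show "f K = 0" using bal[of K] K by auto
    qed (use up that in auto)
    show ?thesis
    proof (rule goal[OF g])
      fix K assume *: "K \<subseteq> M" "Suc (card K) = s"
      show "f (insert x K) = 0"
      \<comment> \<open>As \<open>f\<close> vanishes on the \<open>s\<close>-subsets of
        \<open>M\<close>, only the second sum of \<open>split\<close> survives, with the same
        \<open>j\<close>. Putting \<open>x\<close> into the subset cannot violate the ballot
        condition.\<close>
      proof (rule insert.IH[of "s - 1" j "\<lambda>K. f (insert x K)"])
        fix L assume L: "L \<subseteq> M" "card L = s - 1 + j"
        have "{K. K \<subseteq> L \<and> Suc (card K) = s} = {K. K \<subseteq> L \<and> card K = s - 1}"
          using * by auto
        moreover have "(\<Sum>K | K \<subseteq> L \<and> card K = s. f K) = 0"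
          using g L by (intro sum.neutral) auto
        ultimately show "(\<Sum>K | K \<subseteq> L \<and> card K = s - 1. f (insert x K)) = 0"
          using split[of L] L *(2) by auto
      next
        fix K' assume K: "K' \<subseteq> M" "card K' = s - 1" "ballot j M K'"
        have card: "card (insert x K') = s"
          using K *(2) xM finK[OF K(1)] by (subst card_insert_disjoint) auto
        have "ballot j (insert x M) (insert x K')" unfolding ballot_def
        proof
          fix y
          have eq: "insert x M - insert x K' = M - K'" using xM by auto
          have "card {a \<in> K'. a \<le> y} \<le> card {a \<in> insert x K'. a \<le> y}"
            using finK[OF K(1)] by (intro card_mono) auto
          then show "card {a \<in> insert x M - insert x K'. a \<le> y} < card {a \<in> insert x K'. a \<le> y} + j"
            using K(3) unfolding eq ballot_def by (meson add_le_mono1 order.strict_trans2)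
        qed
        then show "f (insert x K') = 0" using bal[of "insert x K'"] card K by auto
      qed (use * in auto)
    qed
  next
    case False
    show ?thesis
    proof (cases "j = 0")
      case True
      \<comment> \<open>For \<open>j = 0\<close> the set \<open>K\<close> is its own only
        \<open>s\<close>-subset, so the hypothesis for \<open>L = K\<close> is the claim.\<close>
      have fK: "finite K" using insert.prems insert.hyps finite_subset by blast
      then have "{K'. K' \<subseteq> K \<and> card K' = s} = {K}"
        using insert.prems card_subset_eq[OF fK] by auto
      then show ?thesis using up[of K] insert.prems True by simp
    next
      case j: False
      \<comment> \<open>When \<open>M\<close> is this large, the ballot inequality fails at
        \<open>x\<close>, where all of \<open>M\<close> is counted. The ballot hypothesis is
        therefore vacuous in both uses of the induction hypothesis below.\<close>
      have noballot: "\<not> ballot j' M K"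
        if "K \<subseteq> M" "card M \<ge> 2 * card K + j'" for K j'
      proof
        assume "ballot j' M K"
        then have "card {a \<in> M - K. a \<le> x} < card {a \<in> K. a \<le> x} + j'" by (simp add: ballot_def)
        then have "card (M - K) < card K + j'" using full[of K x] full[of "M - K" x] that by auto
        moreover have "card (M - K) = card M - card K" using card_Diff_subset finK that by blast
        ultimately show False using that by simp
      qed
      \<comment> \<open>Here the exponent rises. Adding \<open>split\<close> over all
        \<open>L - {a}\<close> gives \<open>j\<close> times the sum of \<open>f\<close> over
        \<open>s\<close>-subsets of \<open>L\<close>, which is zero, plus \<open>j + 1\<close> times
        the sum that has to vanish.\<close>
      have h: "f (insert x K) = 0" if "K \<subseteq> M" "Suc (card K) = s" for K
      proof (rule insert.IH[of "s - 1" "Suc j" "\<lambda>K. f (insert x K)"])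
        fix L assume L: "L \<subseteq> M" "card L = s - 1 + Suc j"
        have eq: "{K. K \<subseteq> N \<and> Suc (card K) = s} = {K. K \<subseteq> N \<and> card K = s - 1}" for N :: "'a set"
          using that by auto
        have "0 = (\<Sum>a\<in>L. (\<Sum>K | K \<subseteq> L - {a} \<and> card K = s. f K) +
            (\<Sum>K | K \<subseteq> L - {a} \<and> card K = s - 1. f (insert x K)))"
        proof (rule sum.neutral[symmetric], rule ballI)
          fix a assume "a \<in> L"
          then show "(\<Sum>K | K \<subseteq> L - {a} \<and> card K = s. f K) +
            (\<Sum>K | K \<subseteq> L - {a} \<and> card K = s - 1. f (insert x K)) = 0"
            using split[of "L - {a}"] L that finK[OF L(1)] unfolding eq
            by (auto simp: card_Diff_singleton)
        qed
        also have "\<dots> = (real (card L) - real s) * (\<Sum>K | K \<subseteq> L \<and> card K = s. f K) +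
            (real (card L) - real (s - 1)) * (\<Sum>K | K \<subseteq> L \<and> card K = s - 1. f (insert x K))"
          by (simp add: sum.distrib sum_subsets_remove[OF finK[OF L(1)]])
        also have "(\<Sum>K | K \<subseteq> L \<and> card K = s. f K) = 0" using up[of L] L that by auto
        finally have "(real (card L) - real (s - 1)) *
          (\<Sum>K | K \<subseteq> L \<and> card K = s - 1. f (insert x K)) = 0" by simp
        then show "(\<Sum>K | K \<subseteq> L \<and> card K = s - 1. f (insert x K)) = 0" using L by simp
      next
        fix K' assume "K' \<subseteq> M" "card K' = s - 1" "ballot (Suc j) M K'"
        then show "f (insert x K') = 0" using noballot[of K' "Suc j"] False that by simp
      qed (use that in auto)
      show ?thesis
      proof (rule goal[OF _ h])
        fix K assume *: "K \<subseteq> M" "card K = s"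
        show "f K = 0"
        \<comment> \<open>With the subsets containing \<open>x\<close> settled, \<open>split\<close>
          kills \<open>f\<close> on \<open>M\<close> already for \<open>j - 1\<close>, a true
          predecessor since \<open>j\<close> is positive.\<close>
        proof (rule insert.IH[of s "j - 1" f])
          fix L assume L: "L \<subseteq> M" "card L = s + (j - 1)"
          have "(\<Sum>K | K \<subseteq> L \<and> Suc (card K) = s. f (insert x K)) = 0"
            using h L by (intro sum.neutral) auto
          then show "(\<Sum>K | K \<subseteq> L \<and> card K = s. f K) = 0" using split[of L] L j by simp
        next
          fix K' assume "K' \<subseteq> M" "card K' = s" "ballot (j - 1) M K'"
          then show "f K' = 0" using noballot[of K' "j - 1"] False j by fastforce
        qed (use * in auto)
      qed
    qed
  qed
qed

section \<open>Coefficients in the exterior algebra\<close>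

lemma gcoeff_mult_gmonom:
  assumes "finite B" "finite S"
  shows "gcoeff (f * gmonom B) S = (if B \<subseteq> S then shuffle_sgn (S - B) B * gcoeff f (S - B) else 0)"
proof -
  have "gcoeff (f * gmonom B) S = (\<Sum>A\<in>Pow S. if A = S - B then
      (if B \<subseteq> S then shuffle_sgn (S - B) B * gcoeff f (S - B) else 0) else 0)"
    unfolding times_grassmann.rep_eq gmonom.rep_eq using assms
    by (intro sum.cong) (auto simp: double_diff)
  then show ?thesis using assms by simp
qed

lemma gcoeff_gmonom_mult:
  assumes "finite B" "finite S"
  shows "gcoeff (gmonom B * f) S = (if B \<subseteq> S then shuffle_sgn B (S - B) * gcoeff f (S - B) else 0)"
proof -
  have "gcoeff (gmonom B * f) S = (\<Sum>A\<in>Pow S. if A = B then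
      (if B \<subseteq> S then shuffle_sgn B (S - B) * gcoeff f (S - B) else 0) else 0)"
    unfolding times_grassmann.rep_eq gmonom.rep_eq using assms
    by (intro sum.cong) auto
  then show ?thesis using assms by simp
qed

lemma shuffle_sgn_neq_0 [simp]: "shuffle_sgn A B \<noteq> 0"
  by (simp add: shuffle_sgn_def)

lemma shuffle_sgn_singleton_right: "shuffle_sgn A {y} = (- 1) ^ card {x \<in> A. y < x}"
proof -
  have "{(a, b). a \<in> A \<and> b \<in> {y} \<and> b < a} = (\<lambda>x. (x, y)) ` {x \<in> A. y < x}" by auto
  then show ?thesis by (simp add: shuffle_sgn_def card_image inj_on_def)
qed

lemma shuffle_sgn_singleton_left: "shuffle_sgn {y} A = (- 1) ^ card {x \<in> A. x < y}"
proof -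
  have "{(a, b). a \<in> {y} \<and> b \<in> A \<and> b < a} = Pair y ` {x \<in> A. x < y}" by auto
  then show ?thesis by (simp add: shuffle_sgn_def card_image inj_on_def)
qed

lemma gcoeff_arith [simp]:
  "gcoeff 0 S = 0" "gcoeff (f + g) S = gcoeff f S + gcoeff g S"
  "gcoeff (- f) S = - gcoeff f S" "gcoeff (f - g) S = gcoeff f S - gcoeff g S"
  "gcoeff (c *\<^sub>R f) S = c * gcoeff f S"
  unfolding minus_grassmann_def
  by (simp_all only: zero_grassmann.rep_eq plus_grassmann.rep_eq uminus_grassmann.rep_eq
      scaleR_grassmann.rep_eq diff_conv_add_uminus[of "gcoeff f S"])

lemma linear_gcoeff: "linear (\<lambda>f. gcoeff f S)"
  by (rule linearI) simp_all

lemma grassmann_expand: "f = (\<Sum>S | gcoeff f S \<noteq> 0. gcoeff f S *\<^sub>R gmonom S)"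
proof (rule grassmann_eqI)
  fix T :: "'a set" assume T: "finite T"
  have "gcoeff (\<Sum>S | gcoeff f S \<noteq> 0. gcoeff f S *\<^sub>R gmonom S) T =
      (\<Sum>S | gcoeff f S \<noteq> 0. if S = T then gcoeff f T else 0)"
    unfolding gcoeff_sum gcoeff_arith gmonom.rep_eq using T by (intro sum.cong) auto
  then show "gcoeff f T = gcoeff (\<Sum>S | gcoeff f S \<noteq> 0. gcoeff f S *\<^sub>R gmonom S) T"
    by (simp add: finite_gcoeff)
qed

text \<open>Sorting distinct generators changes their product by a sign, recorded here only as a
  nonzero scalar.\<close>

lemma prod_list_gen_distinct:
  assumes "distinct as"
  shows "\<exists>c. c \<noteq> 0 \<and> prod_list (map gen as) = c *\<^sub>R gmonom (set as)"
  using assms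
proof (induction as)
  case Nil
  then show ?case by (auto simp: gmonom_empty intro!: exI[of _ 1])
next
  case (Cons a as)
  then obtain c where "c \<noteq> 0" "prod_list (map gen as) = c *\<^sub>R gmonom (set as)" by auto
  then have "prod_list (map gen (a # as)) = c *\<^sub>R (gmonom {a} * gmonom (set as))"
    by (simp add: gen_def)
  also have "\<dots> = (c * shuffle_sgn {a} (set as)) *\<^sub>R gmonom (set (a # as))"
    using Cons.prems by (simp add: gmonom_mult)
  finally show ?case using \<open>c \<noteq> 0\<close>
    by (intro exI[of _ "c * shuffle_sgn {a} (set as)"]) simp
qed

section \<open>Supports of the elements of the exterior powers\<close>

definition heis_labels :: "nat \<Rightarrow> heis_label set"
  where "heis_labels n = insert Theta (DX ` {1..n} \<union> DY ` {1..n})"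

text \<open>Covectors are supported on singletons, and a monomial of a product is a disjoint union
  of monomials of the factors. Conversely, each monomial of size \<open>m\<close> is a product of
  \<open>m\<close> generators.\<close>

lemma ext_power_iff:
  "f \<in> ext_power n m \<longleftrightarrow> (\<forall>S. gcoeff f S \<noteq> 0 \<longrightarrow> S \<subseteq> heis_labels n \<and> card S = m)"
proof
  define supp where "supp m f \<longleftrightarrow> (\<forall>S. gcoeff f S \<noteq> 0 \<longrightarrow> S \<subseteq> heis_labels n \<and> card S = m)"
    for m and f :: heis_form
  have supp_span: "supp m f" if "f \<in> span X" "\<And>x. x \<in> X \<Longrightarrow> supp m x" for m f X
    using that(1)
  proof (induction rule: span_induct_alt)
    case (step c x y)
    show ?case unfolding supp_def
    proof (intro allI impI)
      fix S assume "gcoeff (c *\<^sub>R x + y) S \<noteq> 0"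
      then have "gcoeff x S \<noteq> 0 \<or> gcoeff y S \<noteq> 0" by auto
      then show "S \<subseteq> heis_labels n \<and> card S = m"
        using that(2)[OF step(1)] step(2) by (auto simp: supp_def)
    qed
  qed (simp add: supp_def)
  have cov: "supp 1 f" if "f \<in> heis_covectors n" for f
    using that unfolding heis_covectors_def
    by (rule supp_span)
       (auto simp: supp_def dx_def dy_def theta_def gen_def gmonom.rep_eq heis_labels_def
         split: if_splits)
  have prod: "supp (length vs) (prod_list vs)" if "set vs \<subseteq> heis_covectors n" for vs
    using that
  proof (induction vs)
    case Nil
    then show ?case by (simp add: supp_def one_grassmann.rep_eq)
  next
    case (Cons v vs)
    show ?case unfolding supp_def
    proof (intro allI impI)
      fix S assume S: "gcoeff (prod_list (v # vs)) S \<noteq> 0"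
      then have finS: "finite S" using gcoeff_infinite by blast
      from S have "(\<Sum>A\<in>Pow S. shuffle_sgn A (S - A) * gcoeff v A * gcoeff (prod_list vs) (S - A)) \<noteq> 0"
        by (simp add: times_grassmann.rep_eq)
      then obtain A where A: "A \<in> Pow S" "gcoeff v A \<noteq> 0" "gcoeff (prod_list vs) (S - A) \<noteq> 0"
        by (rule sum.not_neutral_contains_not_neutral) auto
      then have *: "A \<subseteq> heis_labels n" "card A = 1" "S - A \<subseteq> heis_labels n" "card (S - A) = length vs"
        using cov[of v] Cons by (auto simp: supp_def)
      have "card (S - A) = card S - card A" "card A \<le> card S"
        using A(1) finS by (auto simp: card_Diff_subset finite_subset card_mono)
      with * show "S \<subseteq> heis_labels n \<and> card S = length (v # vs)" by auto
    qed
  qed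
  {
    assume "f \<in> ext_power n m"
    then have "supp m f" unfolding ext_power_def by (rule supp_span) (use prod in blast)
    then show "\<forall>S. gcoeff f S \<noteq> 0 \<longrightarrow> S \<subseteq> heis_labels n \<and> card S = m" by (simp add: supp_def)
  }
  assume *: "\<forall>S. gcoeff f S \<noteq> 0 \<longrightarrow> S \<subseteq> heis_labels n \<and> card S = m"
  have gen: "gen a \<in> heis_covectors n" if "a \<in> heis_labels n" for a
    unfolding heis_covectors_def
    by (rule span_base) (use that in \<open>auto simp: heis_labels_def dx_def dy_def theta_def\<close>)
  have "gmonom S \<in> ext_power n m" if "gcoeff f S \<noteq> 0" for S
  proof -
    have S: "S \<subseteq> heis_labels n" "card S = m" using * that by auto
    have finS: "finite S" using that gcoeff_infinite by blast
    have "gmonom S = prod_list (map gen (sorted_list_of_set S))"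
      using gmonom_eq_prod_list[of "sorted_list_of_set S"] finS by simp
    moreover have "length (map gen (sorted_list_of_set S)) = m"
      "set (map gen (sorted_list_of_set S)) \<subseteq> heis_covectors n"
      using S finS gen by auto
    ultimately show ?thesis unfolding ext_power_def by (intro span_base) blast
  qed
  then have "(\<Sum>S | gcoeff f S \<noteq> 0. gcoeff f S *\<^sub>R gmonom S) \<in> ext_power n m"
    unfolding ext_power_def by (intro span_sum span_scale) auto
  then show "f \<in> ext_power n m" using grassmann_expand[of f] by simp
qed

section \<open>The two-forms \<open>dxy a\<close> as central factors without signs\<close>

definition xy_labels :: "nat set \<Rightarrow> heis_label set"
  where "xy_labels K = DX ` K \<union> DY ` K"

text \<open>The labels of the factor \<open>dx_I \<and> dy_J \<and> \<theta>\<close>, which stays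
  fixed while the remaining part \<open>xy_labels K\<close> of a monomial varies.\<close>

definition outer_labels :: "nat set \<Rightarrow> nat set \<Rightarrow> heis_label set"
  where "outer_labels I J = insert Theta (DX ` I \<union> DY ` J)"

lemma finite_xy_labels [simp]: "finite K \<Longrightarrow> finite (xy_labels K)"
  and finite_outer_labels [simp]: "finite I \<Longrightarrow> finite J \<Longrightarrow> finite (outer_labels I J)"
  by (simp_all add: xy_labels_def outer_labels_def)

text \<open>The keys of \<open>DX a\<close> and \<open>DY a\<close> are consecutive, so no other
  label lies between them.\<close>

lemma label_less_iff:
  assumes "x \<noteq> DX a" "x \<noteq> DY a"
  shows "DX a < x \<longleftrightarrow> DY a < x" "x < DX a \<longleftrightarrow> x < DY a"
  using assms by (cases x; auto simp: less_heis_label_def)+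

text \<open>Every label outside the pair is inverted with both of \<open>DX a\<close> and
  \<open>DY a\<close> or with neither, so the sign is a square.\<close>

lemma shuffle_sgn_xy_labels:
  assumes "finite A" "xy_labels {a} \<inter> A = {}"
  shows "shuffle_sgn A (xy_labels {a}) = 1" "shuffle_sgn (xy_labels {a}) A = 1"
proof -
  have A: "x \<noteq> DX a \<and> x \<noteq> DY a" if "x \<in> A" for x using assms that by (auto simp: xy_labels_def)
  have eq: "xy_labels {a} = {DX a} \<union> {DY a}" by (auto simp: xy_labels_def)
  have "{x \<in> A. DX a < x} = {x \<in> A. DY a < x}" "{x \<in> A. x < DX a} = {x \<in> A. x < DY a}"
    using A label_less_iff by blast+
  then have "shuffle_sgn A {DX a} = shuffle_sgn A {DY a}" "shuffle_sgn {DX a} A = shuffle_sgn {DY a} A"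
    by (simp_all add: shuffle_sgn_singleton_right shuffle_sgn_singleton_left)
  moreover have "s * s = 1" if "s = shuffle_sgn B C" for s and B C :: "heis_label set"
    using that by (simp add: shuffle_sgn_def flip: power_mult_distrib)
  moreover have "shuffle_sgn A (xy_labels {a}) = shuffle_sgn A {DX a} * shuffle_sgn A {DY a}"
    "shuffle_sgn (xy_labels {a}) A = shuffle_sgn {DX a} A * shuffle_sgn {DY a} A"
    unfolding eq using assms(1)
    by (intro shuffle_sgn_Un_right shuffle_sgn_Un_left; simp)+
  ultimately show "shuffle_sgn A (xy_labels {a}) = 1" "shuffle_sgn (xy_labels {a}) A = 1"
    by simp_all
qed

lemma dxy_eq_gmonom: "dxy a = gmonom (xy_labels {a})"
proof -
  have "sorted_wrt (<) [DX a, DY a]" by (simp add: less_heis_label_def)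
  from gmonom_eq_prod_list[OF this] show ?thesis
    by (simp add: dxy_def dx_def dy_def xy_labels_def insert_commute)
qed

text \<open>The order on the labels keeps \<open>DX a\<close> and \<open>DY a\<close> adjacent, so no sign appears.\<close>

lemma gcoeff_dxy_mult:
  "gcoeff (dxy a * f) S = (if xy_labels {a} \<subseteq> S then gcoeff f (S - xy_labels {a}) else 0)"
proof (cases "finite S")
  case True
  then show ?thesis
    by (simp add: dxy_eq_gmonom gcoeff_gmonom_mult shuffle_sgn_xy_labels)
next
  case False
  moreover from False have "infinite (S - xy_labels {a})" by simp
  ultimately show ?thesis by (simp add: gcoeff_infinite)
qed

lemma dxy_central: "f * dxy a = dxy a * f"
proof (rule grassmann_eqI)
  fix S :: "heis_label set" assume "finite S"
  then show "gcoeff (f * dxy a) S = gcoeff (dxy a * f) S"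
    by (simp add: dxy_eq_gmonom gcoeff_gmonom_mult gcoeff_mult_gmonom shuffle_sgn_xy_labels)
qed

lemma dxy_square: "dxy a * dxy a = 0"
  by (simp add: dxy_eq_gmonom gmonom_mult xy_labels_def)

text \<open>Products of the central forms \<open>dxy a\<close> and their differences are central, so
  \<open>alpha R\<close> moves to the front; the rest is a nonzero multiple of one monomial. The
  scalar depends on \<open>I\<close> and \<open>J\<close> but not on \<open>R\<close>.\<close>

lemma J_element_eq:
  assumes "finite I" "finite J"
  obtains c where "c \<noteq> 0" "\<And>R. J_element (I, J, R) = c *\<^sub>R (alpha R * gmonom (outer_labels I J))"
proof -
  define as where "as = map DX (sorted_list_of_set I) @ map DY (sorted_list_of_set J) @ [Theta]"
  have "distinct as" "set as = outer_labels I J"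
    using assms by (auto simp: as_def outer_labels_def distinct_map inj_on_def)
  then obtain c where c: "c \<noteq> 0" "prod_list (map gen as) = c *\<^sub>R gmonom (outer_labels I J)"
    using prod_list_gen_distinct by metis
  have as: "prod_list (map gen as) = dx_set I * dy_set J * theta"
    by (simp add: as_def dx_set_def dy_set_def theta_def dx_def[abs_def] dy_def[abs_def] comp_def
        mult.assoc)
  have central: "f * prod_list (map h xs) = prod_list (map h xs) * f"
    if h: "\<And>x f. f * h x = h x * f" for f :: heis_form and h and xs :: "nat list"
  proof (induction xs)
    case (Cons x xs)
    have "f * (h x * prod_list (map h xs)) = (h x * f) * prod_list (map h xs)"
      by (simp only: mult.assoc[symmetric] h[of f])
    also have "\<dots> = h x * prod_list (map h xs) * f" by (simp only: mult.assoc Cons.IH)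
    finally show ?case by simp
  qed simp
  have "f * alpha R = alpha R * f" for f R
  proof -
    define A where "A = prod_list (map (\<lambda>j. dxy (fst R ! j) - dxy (snd R ! j)) [0..<length (snd R)])"
    define B where "B = prod_list (map (\<lambda>j. dxy (fst R ! j)) [length (snd R)..<length (fst R)])"
    have "f * A = A * f"
      unfolding A_def by (rule central) (simp add: left_diff_distrib right_diff_distrib dxy_central)
    moreover have "f * B = B * f"
      unfolding B_def by (rule central) (rule dxy_central)
    ultimately have "(f * A) * B = A * (B * f)" by (simp add: mult.assoc)
    then show ?thesis by (simp add: alpha_def A_def B_def mult.assoc)
  qed
  note alpha_central = this
  have "J_element (I, J, R) = c *\<^sub>R (alpha R * gmonom (outer_labels I J))" for R
  proof -
    have "J_element (I, J, R) = (dx_set I * dy_set J * alpha R) * theta" by (simp add: J_element_def)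
    also have "\<dots> = alpha R * (dx_set I * dy_set J * theta)"
      unfolding alpha_central[of "dx_set I * dy_set J"] by (rule mult.assoc)
    also have "\<dots> = c *\<^sub>R (alpha R * gmonom (outer_labels I J))"
      using c(2) as by simp
    finally show ?thesis .
  qed
  with c(1) that show thesis by blast
qed

section \<open>Leading monomials of tableau forms\<close>

text \<open>The leading monomial is the one with the smallest sum of indices. Strictness for
  \<open>K \<noteq> A\<close> later yields triangularity, and the equal cardinalities fix the
  degree.\<close>

definition leads :: "heis_label set \<Rightarrow> nat set \<Rightarrow> nat set \<Rightarrow> heis_form \<Rightarrow> bool"
  where "leads B M A f \<longleftrightarrow> gcoeff f (xy_labels A \<union> B) = 1 \<and>
    (\<forall>S. gcoeff f S \<noteq> 0 \<longrightarrow>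
      (\<exists>K\<subseteq>M. S = xy_labels K \<union> B \<and> card K = card A \<and> (K = A \<or> \<Sum>A < \<Sum>K)))"

lemma leadsD:
  assumes "leads B M A f" "gcoeff f S \<noteq> 0"
  obtains K where "K \<subseteq> M" "S = xy_labels K \<union> B" "card K = card A" "K = A \<or> \<Sum>A < \<Sum>K"
  using assms unfolding leads_def by blast

lemma leads_gmonom: "finite B \<Longrightarrow> leads B {} {} (gmonom B)"
  by (auto simp: leads_def gmonom.rep_eq xy_labels_def split: if_splits)

lemma xy_labels_insert: "xy_labels (insert a K) = xy_labels {a} \<union> xy_labels K"
  by (auto simp: xy_labels_def)

lemma gcoeff_dxy_mult_leads:
  assumes "leads B M A f" "a \<notin> M" "xy_labels {a} \<inter> B = {}" "gcoeff (dxy a * f) S \<noteq> 0"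
  obtains K where "K \<subseteq> M" "S = xy_labels (insert a K) \<union> B" "card K = card A"
    "K = A \<or> \<Sum>A < \<Sum>K"
proof -
  from assms(4) have S: "xy_labels {a} \<subseteq> S" "gcoeff f (S - xy_labels {a}) \<noteq> 0"
    by (auto simp: gcoeff_dxy_mult split: if_splits)
  from assms(1) S(2) obtain K where K: "K \<subseteq> M" "S - xy_labels {a} = xy_labels K \<union> B"
    "card K = card A" "K = A \<or> \<Sum>A < \<Sum>K" by (rule leadsD)
  have "S = xy_labels (insert a K) \<union> B" using S(1) K(2) by (subst xy_labels_insert) auto
  with K that show thesis by blast
qed

lemma gcoeff_dxy_mult_lead:
  assumes "leads B M A f" "a \<notin> A" "xy_labels {a} \<inter> B = {}"
  shows "gcoeff (dxy a * f) (xy_labels (insert a A) \<union> B) = 1"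
proof -
  have "xy_labels {a} \<inter> xy_labels A = {}" using assms(2) by (auto simp: xy_labels_def)
  then have "xy_labels (insert a A) \<union> B - xy_labels {a} = xy_labels A \<union> B"
    using assms(3) by (subst xy_labels_insert) auto
  moreover have "xy_labels {a} \<subseteq> xy_labels (insert a A) \<union> B" by (auto simp: xy_labels_def)
  ultimately show ?thesis using assms(1) by (simp add: gcoeff_dxy_mult leads_def)
qed

lemma leads_dxy_mult:
  assumes "leads B M A f" "finite M" "A \<subseteq> M" "a \<notin> M" "xy_labels {a} \<inter> B = {}"
  shows "leads B (insert a M) (insert a A) (dxy a * f)"
  unfolding leads_def
proof (intro conjI allI impI)
  show "gcoeff (dxy a * f) (xy_labels (insert a A) \<union> B) = 1"
    using assms by (intro gcoeff_dxy_mult_lead) auto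
  fix S assume "gcoeff (dxy a * f) S \<noteq> 0"
  from gcoeff_dxy_mult_leads[OF assms(1,4,5) this] obtain K where K: "K \<subseteq> M"
    "S = xy_labels (insert a K) \<union> B" "card K = card A" "K = A \<or> \<Sum>A < \<Sum>K" .
  have "finite K" "a \<notin> K" "finite A" "a \<notin> A" using K assms finite_subset by blast+
  with K show "\<exists>K\<subseteq>insert a M. S = xy_labels K \<union> B \<and> card K = card (insert a A) \<and>
      (K = insert a A \<or> \<Sum>(insert a A) < \<Sum>K)"
    by (intro exI[of _ "insert a K"]) auto
qed

text \<open>Choosing \<open>b\<close> instead of \<open>a\<close> makes the index sum larger because
  \<open>a < b\<close>. The new leading monomial lacks \<open>DX b\<close>, so the term with
  \<open>dxy b\<close> contributes nothing to its coefficient.\<close>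

lemma leads_dxy_diff_mult:
  assumes "leads B M A f" "finite M" "A \<subseteq> M" "a \<notin> M" "b \<notin> M" "a < b"
    "xy_labels {a} \<inter> B = {}" "xy_labels {b} \<inter> B = {}"
  shows "leads B (insert a (insert b M)) (insert a A) ((dxy a - dxy b) * f)"
  unfolding leads_def
proof (intro conjI allI impI)
  have "DX b \<notin> xy_labels (insert a A) \<union> B" using assms by (auto simp: xy_labels_def)
  then have "gcoeff (dxy b * f) (xy_labels (insert a A) \<union> B) = 0"
    by (auto simp: gcoeff_dxy_mult xy_labels_def)
  moreover have "gcoeff (dxy a * f) (xy_labels (insert a A) \<union> B) = 1"
    using assms by (intro gcoeff_dxy_mult_lead) auto
  ultimately show "gcoeff ((dxy a - dxy b) * f) (xy_labels (insert a A) \<union> B) = 1"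
    by (simp add: left_diff_distrib)
  fix S assume "gcoeff ((dxy a - dxy b) * f) S \<noteq> 0"
  then obtain c where c: "c = a \<or> c = b" "gcoeff (dxy c * f) S \<noteq> 0"
    by (cases "gcoeff (dxy a * f) S = 0") (auto simp: left_diff_distrib)
  have "c \<notin> M" "xy_labels {c} \<inter> B = {}" using c assms by auto
  from gcoeff_dxy_mult_leads[OF assms(1) this c(2)] obtain K where K: "K \<subseteq> M"
    "S = xy_labels (insert c K) \<union> B" "card K = card A" "K = A \<or> \<Sum>A < \<Sum>K" .
  have "finite K" "c \<notin> K" "finite A" "a \<notin> A" using K assms finite_subset c by blast+
  with K c assms(6) show "\<exists>K\<subseteq>insert a (insert b M). S = xy_labels K \<union> B \<and>
      card K = card (insert a A) \<and> (K = insert a A \<or> \<Sum>(insert a A) < \<Sum>K)"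
    by (intro exI[of _ "insert c K"]) auto
qed

section \<open>Tableau forms built column by column\<close>

lemma leads_prod_list_dxy:
  assumes "distinct cs" "finite B" "\<And>c. c \<in> set cs \<Longrightarrow> xy_labels {c} \<inter> B = {}"
  shows "leads B (set cs) (set cs) (prod_list (map dxy cs) * gmonom B)"
  using assms
proof (induction cs)
  case Nil
  then show ?case by (simp add: leads_gmonom)
next
  case (Cons c cs)
  then have "leads B (insert c (set cs)) (insert c (set cs)) (dxy c * (prod_list (map dxy cs) * gmonom B))"
    by (intro leads_dxy_mult) auto
  then show ?case by (simp add: mult.assoc)
qed

text \<open>The list \<open>ps\<close> holds the columns of height two and \<open>cs\<close> the
  rest of the first row, so that an induction can remove one column at a time.\<close>

definition alpha_lists :: "(nat \<times> nat) list \<Rightarrow> nat list \<Rightarrow> heis_form"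
  where "alpha_lists ps cs =
    prod_list (map (\<lambda>(a, b). dxy a - dxy b) ps) * prod_list (map dxy cs)"

lemma alpha_lists_Nil: "alpha_lists [] cs = prod_list (map dxy cs)"
  and alpha_lists_Cons: "alpha_lists ((a, b) # ps) cs = (dxy a - dxy b) * alpha_lists ps cs"
  by (simp_all add: alpha_lists_def mult.assoc)

lemma alpha_eq_alpha_lists:
  assumes "length (snd R) \<le> length (fst R)"
  shows "alpha R = alpha_lists (zip (fst R) (snd R)) (drop (length (snd R)) (fst R))"
proof -
  have "map (\<lambda>j. dxy (fst R ! j) - dxy (snd R ! j)) [0..<length (snd R)] =
      map (\<lambda>(a, b). dxy a - dxy b) (zip (fst R) (snd R))"
    using assms by (intro nth_equalityI) auto
  moreover have "map (\<lambda>j. dxy (fst R ! j)) [length (snd R)..<length (fst R)] =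
      map dxy (drop (length (snd R)) (fst R))"
    using assms by (intro nth_equalityI) auto
  ultimately show ?thesis by (simp add: alpha_def alpha_lists_def)
qed

lemma leads_alpha_lists:
  assumes "distinct (map fst ps @ map snd ps @ cs)" "\<And>a b. (a, b) \<in> set ps \<Longrightarrow> a < b" "finite B"
    and "\<And>c. c \<in> set (map fst ps @ map snd ps @ cs) \<Longrightarrow> xy_labels {c} \<inter> B = {}"
  shows "leads B (set (map fst ps @ map snd ps @ cs)) (set (map fst ps @ cs))
    (alpha_lists ps cs * gmonom B)"
  using assms
proof (induction ps)
  case Nil
  then show ?case using leads_prod_list_dxy[of cs B] by (simp add: alpha_lists_Nil)
next
  case (Cons p ps)
  obtain a b where p: "p = (a, b)" by force
  let ?M = "set (map fst ps @ map snd ps @ cs)" and ?A = "set (map fst ps @ cs)"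
  have "leads B (insert a (insert b ?M)) (insert a ?A)
      ((dxy a - dxy b) * (alpha_lists ps cs * gmonom B))"
  proof (rule leads_dxy_diff_mult)
    show "leads B ?M ?A (alpha_lists ps cs * gmonom B)"
      using Cons.prems by (intro Cons.IH) (auto simp: p)
    show "a < b" using Cons.prems(2) by (simp add: p)
    show "a \<notin> ?M" "b \<notin> ?M" using Cons.prems(1) by (auto simp: p)
    show "xy_labels {a} \<inter> B = {}" "xy_labels {b} \<inter> B = {}"
      using Cons.prems(4)[of a] Cons.prems(4)[of b] by (auto simp: p)
  qed auto
  moreover have "insert a (insert b ?M) = set (map fst (p # ps) @ map snd (p # ps) @ cs)"
    by (auto simp: p)
  moreover have "insert a ?A = set (map fst (p # ps) @ cs)" by (auto simp: p)
  ultimately show ?case by (simp add: p alpha_lists_Cons mult.assoc)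
qed

text \<open>As the \<open>dxy a\<close> commute and square to zero, \<open>dxy a + dxy b\<close>
  kills \<open>dxy a - dxy b\<close> and each \<open>dxy c\<close> kills itself. These cases exhaust
  the indices of the sum.\<close>

lemma sum_dxy_mult_alpha_lists:
  assumes "distinct (map fst ps @ map snd ps @ cs)"
  shows "(\<Sum>j\<in>set (map fst ps @ map snd ps @ cs). dxy j) * alpha_lists ps cs = 0"
  using assms
proof (induction ps)
  case Nil
  have "dxy j * prod_list (map dxy cs) = 0" if "j \<in> set cs" for j
    using that
  proof (induction cs)
    case (Cons c cs)
    have "dxy j * (dxy c * g) = dxy c * (dxy j * g)" for g
      by (metis dxy_central mult.assoc)
    moreover have "dxy c * (dxy c * g) = 0" for g
      by (simp add: dxy_square flip: mult.assoc)
    ultimately show ?case using Cons by (cases "j = c") auto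
  qed simp
  then show ?case by (simp add: alpha_lists_Nil sum_distrib_right)
next
  case (Cons p ps)
  obtain a b where p: "p = (a, b)" by force
  let ?M = "set (map fst ps @ map snd ps @ cs)"
  have "set (map fst (p # ps) @ map snd (p # ps) @ cs) = insert a (insert b ?M)"
    by (auto simp: p)
  moreover have "a \<notin> insert b ?M" "b \<notin> ?M" using Cons.prems by (auto simp: p)
  ultimately have sum: "(\<Sum>j\<in>set (map fst (p # ps) @ map snd (p # ps) @ cs). dxy j) =
      dxy a + (dxy b + (\<Sum>j\<in>?M. dxy j))"
    by (simp only: sum.insert finite_insert finite_set not_False_eq_True)
  have ab: "(dxy a + dxy b) * (dxy a - dxy b) = 0"
    by (simp add: distrib_right right_diff_distrib dxy_square dxy_central[of "dxy b" a])
  have comm: "f * (dxy a - dxy b) = (dxy a - dxy b) * f" for f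
    by (simp add: algebra_simps dxy_central)
  have "(dxy a + (dxy b + (\<Sum>j\<in>?M. dxy j))) * ((dxy a - dxy b) * alpha_lists ps cs) =
      (dxy a + dxy b) * (dxy a - dxy b) * alpha_lists ps cs +
      (\<Sum>j\<in>?M. dxy j) * (dxy a - dxy b) * alpha_lists ps cs"
    by (simp only: distrib_right mult.assoc add.assoc)
  also have "\<dots> = (dxy a - dxy b) * ((\<Sum>j\<in>?M. dxy j) * alpha_lists ps cs)"
    unfolding ab comm[of "\<Sum>j\<in>?M. dxy j"] by (simp add: mult.assoc)
  also have "\<dots> = 0" using Cons by (simp add: p)
  finally show ?case unfolding sum by (simp only: p alpha_lists_Cons)
qed

lemma tableau_lists:
  assumes "young_tableau M R"
  defines "ps \<equiv> zip (fst R) (snd R)" and "cs \<equiv> drop (length (snd R)) (fst R)"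
  shows "map fst ps @ cs = fst R" "map snd ps = snd R" "set (map fst ps @ map snd ps @ cs) = M"
    "distinct (map fst ps @ map snd ps @ cs)" "alpha R = alpha_lists ps cs"
proof -
  have R: "distinct (fst R @ snd R)" "set (fst R @ snd R) = M" "length (snd R) \<le> length (fst R)"
    using assms by (auto simp: young_tableau_def)
  show 1: "map fst ps @ cs = fst R" "map snd ps = snd R"
    using R(3) by (simp_all add: ps_def cs_def map_fst_zip_take map_snd_zip_take)
  have "mset (map fst ps @ map snd ps @ cs) = mset ((map fst ps @ cs) @ snd R)"
    by (simp add: 1(2))
  then have "mset (map fst ps @ map snd ps @ cs) = mset (fst R @ snd R)" by (simp only: 1(1))
  then show "set (map fst ps @ map snd ps @ cs) = M" "distinct (map fst ps @ map snd ps @ cs)"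
    using R mset_eq_setD mset_eq_imp_distinct_iff by blast+
  show "alpha R = alpha_lists ps cs" using alpha_eq_alpha_lists[OF R(3)] by (simp add: ps_def cs_def)
qed

text \<open>The columns of a standard tableau increase downwards, so taking the smaller entry of
  every column selects exactly the first row.\<close>

lemma leads_alpha:
  assumes "young_tableau M R" "standard_tableau R" "finite B"
    "\<And>c. c \<in> M \<Longrightarrow> xy_labels {c} \<inter> B = {}"
  shows "leads B M (set (fst R)) (alpha R * gmonom B)"
proof -
  note lists = tableau_lists[OF assms(1)]
  have "a < b" if "(a, b) \<in> set (zip (fst R) (snd R))" for a b
    using that assms(2) by (auto simp: standard_tableau_def in_set_zip)
  then show ?thesis
    using leads_alpha_lists[OF lists(4) _ assms(3)] assms(4) unfolding lists(1,3,5) by blast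
qed

lemma sum_dxy_mult_alpha:
  assumes "young_tableau M R"
  shows "(\<Sum>j\<in>M. dxy j) * alpha R = 0"
  using sum_dxy_mult_alpha_lists[OF tableau_lists(4)[OF assms]] tableau_lists(3,5)[OF assms]
  by simp

text \<open>If the \<open>i\<close>-th column, counted from 0, did not increase, then with
  \<open>x\<close> its lower entry at least \<open>i + 1\<close> elements of \<open>M - K\<close>,
  but at most \<open>i\<close> elements of \<open>K\<close>, would be \<open>\<le> x\<close>,
  against the ballot condition.\<close>

lemma ballot_tableau:
  fixes K M :: "nat set"
  assumes "finite M" "K \<subseteq> M" "ballot 1 M K"
  defines "R \<equiv> (sorted_list_of_set K, sorted_list_of_set (M - K))"
  shows "young_tableau M R" "standard_tableau R"
proof -
  have fin: "finite K" "finite (M - K)" using assms finite_subset by auto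
  have le: "card {a \<in> M - K. a \<le> x} \<le> card {a \<in> K. a \<le> x}" for x
    using assms(3) by (auto simp: ballot_def less_Suc_eq_le)
  \<comment> \<open>An upper bound of \<open>M\<close> that makes sense for empty \<open>M\<close>
    too; the ballot inequality there compares the lengths of the two rows.\<close>
  have "{a \<in> A. a \<le> Max (insert 0 M)} = A" if "A \<subseteq> M" for A
    using that assms(1) by (auto intro!: Max_ge)
  from le[of "Max (insert 0 M)"] this[of K] this[of "M - K"] assms(2)
  have "card (M - K) \<le> card K" by (metis Diff_subset)
  then show "young_tableau M R"
    using fin assms(2) by (auto simp: R_def young_tableau_def)
  have "fst R ! i < snd R ! i" if i: "i < length (snd R)" for i
  proof (rule ccontr)
    assume not: "\<not> fst R ! i < snd R ! i"
    let ?x = "snd R ! i"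
    have snd: "set (snd R) = M - K" "sorted (snd R)" "distinct (snd R)"
      and fst: "set (fst R) = K" "sorted (fst R)" "length (fst R) = card K"
      using fin by (auto simp: R_def)
    have i': "i < length (fst R)" using i \<open>card (M - K) \<le> card K\<close> by (simp add: R_def)
    then have ne: "fst R ! i \<noteq> ?x" using i snd(1) fst(1) nth_mem by (metis DiffD2)
    have "Suc i = card ((!) (snd R) ` {..i})"
      using i snd(3) by (subst card_image) (auto simp: inj_on_def nth_eq_iff_index_eq)
    also have "\<dots> \<le> card {a \<in> M - K. a \<le> ?x}"
    proof (rule card_mono)
      show "(!) (snd R) ` {..i} \<subseteq> {a \<in> M - K. a \<le> ?x}"
        using i snd sorted_nth_mono[of "snd R"] nth_mem[of _ "snd R"] by fastforce
    qed (use fin in auto)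
    also have "\<dots> \<le> card {a \<in> K. a \<le> ?x}" by (rule le)
    also have "\<dots> \<le> card ((!) (fst R) ` {..<i})"
    proof (rule card_mono)
      show "{a \<in> K. a \<le> ?x} \<subseteq> (!) (fst R) ` {..<i}"
      proof
        fix a assume a: "a \<in> {a \<in> K. a \<le> ?x}"
        then obtain j where j: "j < length (fst R)" "a = fst R ! j"
          using fst(1) by (metis (no_types, lifting) in_set_conv_nth mem_Collect_eq)
        have "j < i"
          using sorted_nth_mono[OF fst(2), of i j] j a not ne by (cases "j < i") auto
        with j show "a \<in> (!) (fst R) ` {..<i}" by auto
      qed
    qed simp
    also have "\<dots> \<le> i" using card_image_le[of "{..<i}" "(!) (fst R)"] by simp
    finally show False by simp
  qed
  then show "standard_tableau R" using fin by (simp add: standard_tableau_def R_def)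
qed

section \<open>The basis\<close>

text \<open>A monomial determines its three index sets: an index belongs to \<open>K\<close> if both
  its labels occur, to \<open>I\<close> if only \<open>DX\<close> does, and to \<open>J\<close> if
  only \<open>DY\<close> does.\<close>

lemma label_sets_eqD:
  assumes "xy_labels K \<union> outer_labels I J = xy_labels K' \<union> outer_labels I' J'"
    and "I \<inter> J = {}" "I' \<inter> J' = {}" "K \<inter> (I \<union> J) = {}" "K' \<inter> (I' \<union> J') = {}"
  shows "K = K'" "I = I'" "J = J'"
proof -
  have x: "i \<in> K \<or> i \<in> I \<longleftrightarrow> i \<in> K' \<or> i \<in> I'" and y: "i \<in> K \<or> i \<in> J \<longleftrightarrow> i \<in> K' \<or> i \<in> J'" for i
    using eqset_imp_iff[OF assms(1), of "DX i"] eqset_imp_iff[OF assms(1), of "DY i"]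
    by (auto simp: xy_labels_def outer_labels_def)
  show "K = K'" "I = I'" "J = J'" using x y assms(2-) by blast+
qed

lemma card_label_set:
  assumes "finite K" "finite I" "finite J" "K \<inter> (I \<union> J) = {}"
  shows "card (xy_labels K \<union> outer_labels I J) = 2 * card K + card I + card J + 1"
proof -
  have "xy_labels K \<union> outer_labels I J = insert Theta (DX ` (K \<union> I) \<union> DY ` (K \<union> J))"
    by (auto simp: xy_labels_def outer_labels_def)
  also have "card \<dots> = Suc (card (DX ` (K \<union> I)) + card (DY ` (K \<union> J)))"
    using assms by (subst card_insert_disjoint, simp, force, subst card_Un_disjoint) auto
  also have "\<dots> = Suc (card (K \<union> I) + card (K \<union> J))"
    by (simp add: card_image inj_on_def)
  also have "\<dots> = 2 * card K + card I + card J + 1"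
    using assms by (subst (1 2) card_Un_disjoint) auto
  finally show ?thesis .
qed

lemma J_indexE:
  assumes "(I, J, R) \<in> J_index n k" "k \<le> n"
  shows "finite I" "finite J" "I \<inter> J = {}" "I \<subseteq> {1..n}" "J \<subseteq> {1..n}"
    "young_tableau ({1..n} - (I \<union> J)) R" "standard_tableau R" "set (fst R) \<subseteq> {1..n} - (I \<union> J)"
    "2 * card (set (fst R)) + card I + card J = 2 * n - k"
proof -
  have *: "I \<subseteq> {1..n}" "J \<subseteq> {1..n}" "I \<inter> J = {}"
    "young_tableau ({1..n} - (I \<union> J)) R" "standard_tableau R"
    "real (length (fst R)) = (2 * real n - real k - real (card I) - real (card J)) / 2"
    using assms by (auto simp: J_index_def)
  then show "finite I" "finite J" "I \<inter> J = {}" "I \<subseteq> {1..n}" "J \<subseteq> {1..n}"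
    "young_tableau ({1..n} - (I \<union> J)) R" "standard_tableau R" "set (fst R) \<subseteq> {1..n} - (I \<union> J)"
    using finite_subset[OF _ finite_atLeastAtMost] by (auto simp: young_tableau_def)
  have "length (fst R) = card (set (fst R))"
    using *(4) by (simp add: young_tableau_def distinct_card)
  \<comment> \<open>The condition on the row length is passed from the reals to the naturals;
    \<open>k \<le> n\<close> makes \<open>2 * n - k\<close> a true difference.\<close>
  then have "real (2 * card (set (fst R)) + card I + card J) = real (2 * n - k)"
    using *(6) assms(2) by (simp add: of_nat_diff)
  then show "2 * card (set (fst R)) + card I + card J = 2 * n - k"
    by (simp only: of_nat_eq_iff)
qed

lemma leads_J_index:
  assumes "(I, J, R) \<in> J_index n k" "k \<le> n"
  shows "leads (outer_labels I J) ({1..n} - (I \<union> J)) (set (fst R)) (alpha R * gmonom (outer_labels I J))"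
  using J_indexE[OF assms] by (intro leads_alpha) (auto simp: xy_labels_def outer_labels_def)

text \<open>All monomials have the size of the leading one, which gives the degree, and a second
  factor \<open>theta\<close> gives zero. For \<open>dtheta n\<close> the indices split: those in
  \<open>I \<union> J\<close> are killed by the outer factor, the others by
  \<open>alpha R\<close>.\<close>

lemma J_element_in_J_space:
  assumes "i \<in> J_index n k" "k \<le> n"
  shows "J_element i \<in> J_space n (2 * n + 1 - k)"
proof -
  obtain I J R where i: "i = (I, J, R)" by (cases i)
  note IJR = J_indexE[OF assms(1)[unfolded i] assms(2)]
  let ?B = "outer_labels I J" and ?M = "{1..n} - (I \<union> J)"
  let ?e = "alpha R * gmonom ?B"
  obtain c where c: "J_element i = c *\<^sub>R ?e"
    using J_element_eq[OF IJR(1,2)] i by metis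
  note lead = leads_J_index[OF assms(1)[unfolded i] assms(2)]
  have "J_element i \<in> ext_power n (2 * n + 1 - k)"
    unfolding ext_power_iff
  proof (intro allI impI)
    fix S assume "gcoeff (J_element i) S \<noteq> 0"
    then have "gcoeff ?e S \<noteq> 0" by (simp add: c)
    with lead obtain K where K: "K \<subseteq> ?M" "S = xy_labels K \<union> ?B" "card K = card (set (fst R))"
      by (rule leadsD)
    have "finite K" using K(1) finite_subset by blast
    then have "card S = 2 * n + 1 - k"
      using K IJR(9) assms(2) card_label_set[OF _ IJR(1,2), of K] by fastforce
    moreover have "S \<subseteq> heis_labels n"
      using K(1,2) IJR(4,5) by (auto simp: xy_labels_def outer_labels_def heis_labels_def)
    ultimately show "S \<subseteq> heis_labels n \<and> card S = 2 * n + 1 - k" by blast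
  qed
  moreover have "J_element i * theta = 0"
    using IJR(1,2) by (simp add: c mult.assoc theta_def gen_def gmonom_mult outer_labels_def)
  moreover have "J_element i * dtheta n = 0"
  proof -
    have 1: "gmonom ?B * dxy j = 0" if "j \<in> I \<union> J" for j
      using that IJR(1,2)
      by (auto simp: dxy_eq_gmonom gmonom_mult outer_labels_def xy_labels_def)
    have "dtheta n = - (\<Sum>j\<in>{1..n}. dxy j)" by (simp add: dtheta_def dxy_def)
    also have "{1..n} = (I \<union> J) \<union> ?M" using IJR(4,5) by auto
    also have "(\<Sum>j\<in>(I \<union> J) \<union> ?M. dxy j) = (\<Sum>j\<in>I \<union> J. dxy j) + (\<Sum>j\<in>?M. dxy j)"
      using IJR(1,2) by (intro sum.union_disjoint) auto
    finally have "?e * dtheta n = - (alpha R * (\<Sum>j\<in>I \<union> J. gmonom ?B * dxy j) + ?e * (\<Sum>j\<in>?M. dxy j))"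
      by (simp add: distrib_left right_diff_distrib mult.assoc sum_distrib_left)
    also have "(\<Sum>j\<in>I \<union> J. gmonom ?B * dxy j) = 0" using 1 by (rule sum.neutral[rule_format])
    also have "?e * (\<Sum>j\<in>?M. dxy j) = (\<Sum>j\<in>?M. dxy j) * ?e"
      by (simp add: sum_distrib_left sum_distrib_right dxy_central)
    also have "\<dots> = 0" using sum_dxy_mult_alpha[OF IJR(6)] by (simp flip: mult.assoc)
    finally show ?thesis by (simp add: c)
  qed
  ultimately show ?thesis by (simp add: J_space_def)
qed

lemma subspace_J_space: "subspace (J_space n m)"
proof -
  have "subspace (ext_power n m)" by (simp add: ext_power_def subspace_span)
  then show ?thesis
    by (auto simp: J_space_def subspace_def distrib_right)
qed

lemma finite_J_index: "finite (J_index n k)"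
proof (rule finite_subset)
  let ?L = "{xs. set xs \<subseteq> {1..n} \<and> length xs \<le> n}"
  have "length xs \<le> n" if "distinct xs" "set xs \<subseteq> {1..n}" for xs
    using card_mono[OF _ that(2)] distinct_card[OF that(1)] by simp
  then show "J_index n k \<subseteq> Pow {1..n} \<times> Pow {1..n} \<times> ?L \<times> ?L"
    by (auto simp: J_index_def young_tableau_def)
  show "finite (Pow {1..n} \<times> Pow {1..n} \<times> ?L \<times> ?L)"
    by (intro finite_cartesian_product finite_lists_length_le) auto
qed

text \<open>For fixed \<open>I\<close> and \<open>J\<close> the coefficients of \<open>v\<close>
  form a function on subsets of \<open>M\<close> killed by the raising operator, and every ballot
  subset of the relevant size is the first row of an indexed tableau. Hence
  \<open>raising_kernel_ballot\<close> applies with \<open>j = 1\<close>.\<close>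

lemma J_space_eq_0:
  assumes "k \<le> n" "v \<in> J_space n (2 * n + 1 - k)"
    and zero: "\<And>I J R. (I, J, R) \<in> J_index n k \<Longrightarrow>
      gcoeff v (xy_labels (set (fst R)) \<union> outer_labels I J) = 0"
  shows "v = 0"
proof (rule grassmann_eqI, rule ccontr)
  fix S :: "heis_label set"
  assume finS: "finite S" and "gcoeff v S \<noteq> gcoeff 0 S"
  then have nz: "gcoeff v S \<noteq> 0" by simp
  have S: "S \<subseteq> heis_labels n" "card S = 2 * n + 1 - k"
    using assms(2) nz by (auto simp: J_space_def ext_power_iff)
  \<comment> \<open>Otherwise \<open>v * theta\<close> would have a nonzero coefficient at
    \<open>insert Theta S\<close>.\<close>
  have "Theta \<in> S"
  proof (rule ccontr)
    assume "Theta \<notin> S"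
    moreover have "gcoeff (v * theta) (insert Theta S) = 0"
      using assms(2) by (simp add: J_space_def)
    ultimately show False
      using nz finS by (simp add: theta_def gen_def gcoeff_mult_gmonom)
  qed
  define I where "I = {i. DX i \<in> S \<and> DY i \<notin> S}"
  define J where "J = {i. DY i \<in> S \<and> DX i \<notin> S}"
  define K where "K = {i. DX i \<in> S \<and> DY i \<in> S}"
  define M where "M = {1..n} - (I \<union> J)"
  let ?B = "outer_labels I J"
  have Seq: "S = xy_labels K \<union> ?B"
  proof (rule set_eqI)
    fix l show "l \<in> S \<longleftrightarrow> l \<in> xy_labels K \<union> ?B"
      using \<open>Theta \<in> S\<close>
      by (cases l) (auto simp: xy_labels_def outer_labels_def I_def J_def K_def)
  qed
  have sub: "I \<subseteq> {1..n}" "J \<subseteq> {1..n}" "K \<subseteq> M" "I \<inter> J = {}"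
    using S(1) by (auto simp: I_def J_def K_def M_def heis_labels_def)
  have "finite M" by (simp add: M_def)
  with sub have fin: "finite I" "finite J" "finite K" "finite M"
    using finite_subset[of I "{1..n}"] finite_subset[of J "{1..n}"] finite_subset[of K M] by auto
  have cardS: "2 * card K + card I + card J = 2 * n - k"
    using S(2) sub fin assms(1) unfolding Seq M_def
    by (subst (asm) card_label_set) auto
  have cardM: "card M + card I + card J = n"
  proof -
    have "card (I \<union> J) = card I + card J" using fin sub by (simp add: card_Un_disjoint)
    moreover have "card M = n - card (I \<union> J)" "card (I \<union> J) \<le> n"
      using fin sub card_mono[of "{1..n}" "I \<union> J"] by (auto simp: M_def card_Diff_subset)
    ultimately show ?thesis by simp
  qed
  define f where "f K' = gcoeff v (xy_labels K' \<union> ?B)" for K'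
  have "f K = 0"
  proof (rule raising_kernel_ballot[where j = 1, OF fin(4) _ _ sub(3) refl])
    fix L assume L: "L \<subseteq> M" "card L = card K + 1"
    have finL: "finite L" using L fin finite_subset by blast
    \<comment> \<open>The coefficient of \<open>v * dtheta n\<close> at this monomial is, up to
      sign, the sum of \<open>f\<close> over the sets \<open>L - {j}\<close> with
      \<open>j \<in> L\<close>.\<close>
    let ?S = "xy_labels L \<union> ?B"
    have "v * (\<Sum>j=1..n. dxy j) = 0"
      using assms(2) by (simp add: J_space_def dtheta_def dxy_def)
    then have "(\<Sum>j=1..n. dxy j * v) = 0" by (simp add: sum_distrib_left dxy_central)
    then have "(\<Sum>j=1..n. gcoeff (dxy j * v) ?S) = 0" by (metis gcoeff_sum gcoeff_arith(1))
    moreover have "gcoeff (dxy j * v) ?S = (if j \<in> L then f (L - {j}) else 0)" for j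
    proof -
      have "xy_labels {j} \<subseteq> ?S \<longleftrightarrow> j \<in> L"
        using sub L(1) by (auto simp: xy_labels_def outer_labels_def M_def)
      moreover have "?S - xy_labels {j} = xy_labels (L - {j}) \<union> ?B" if "j \<in> L"
        using that L(1) by (auto simp: xy_labels_def outer_labels_def M_def)
      ultimately show ?thesis by (simp add: gcoeff_dxy_mult f_def)
    qed
    moreover have "{1..n} \<inter> L = L" using L(1) by (auto simp: M_def)
    ultimately have "(\<Sum>j\<in>L. f (L - {j})) = 0" by (simp add: sum.If_cases)
    also have "(\<Sum>j\<in>L. f (L - {j})) = (\<Sum>K' | K' \<subseteq> L \<and> card K' = card K. f K')"
    proof -
      have "inj_on (\<lambda>j. L - {j}) L" by (auto simp: inj_on_def)
      moreover have "(\<lambda>j. L - {j}) ` L = {K'. K' \<subseteq> L \<and> card K' = card K}"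
      proof (intro equalityI subsetI)
        fix K' assume K': "K' \<in> {K'. K' \<subseteq> L \<and> card K' = card K}"
        then have "card (L - K') = 1"
          using L finL by (auto simp: card_Diff_subset finite_subset)
        then obtain j where "L - K' = {j}" by (auto simp: card_1_singleton_iff)
        then have "j \<in> L" "K' = L - {j}" using K' by auto
        then show "K' \<in> (\<lambda>j. L - {j}) ` L" by auto
      qed (use L finL in \<open>auto simp: card_Diff_singleton\<close>)
      ultimately show ?thesis using sum.reindex[of "\<lambda>j. L - {j}" L f] by (simp add: comp_def)
    qed
    finally show "(\<Sum>K' | K' \<subseteq> L \<and> card K' = card K. f K') = 0" .
  next
    fix K' assume K': "K' \<subseteq> M" "card K' = card K" "ballot 1 M K'"
    define R where "R = (sorted_list_of_set K', sorted_list_of_set (M - K'))"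
    have finK': "finite K'" using K' fin finite_subset by blast
    have R: "young_tableau M R" "standard_tableau R"
      using ballot_tableau[OF fin(4) K'(1,3)] by (simp_all add: R_def)
    have len: "length (fst R) = card K" "length (snd R) = card M - card K" "card K \<le> card M"
      using K' finK' fin card_mono[OF fin(4) sub(3)] by (auto simp: R_def card_Diff_subset)
    \<comment> \<open>The degree of \<open>v\<close> determines the first row length, and counting
      \<open>M\<close> gives the second; the latter also yields
      \<open>card I + card J \<le> k\<close>.\<close>
    have nat: "2 * length (fst R) + k + card I + card J = 2 * n"
      "2 * length (snd R) + card I + card J = k"
      using len cardS cardM assms(1) by linarith+
    have "real (length (fst R)) = (2 * real n - real k - real (card I) - real (card J)) / 2"
      using arg_cong[OF nat(1), of real] by simp
    moreover have "real (length (snd R)) = (real k - real (card I) - real (card J)) / 2"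
      using arg_cong[OF nat(2), of real] by simp
    moreover have "card I + card J \<le> k" using nat(2) by simp
    ultimately have "(I, J, R) \<in> J_index n k"
      using R sub by (simp add: J_index_def M_def)
    from zero[OF this] show "f K' = 0" using finK' by (simp add: f_def R_def)
  qed
  then show False using nz Seq by (simp add: f_def)
qed

theorem proposition1p10:
  fixes n k :: nat
  assumes "n \<ge> 1" and "k \<in> {1..n}"
  shows "inj_on J_element (J_index n k) \<and>
         independent (J_element ` J_index n k) \<and>
         span (J_element ` J_index n k) = J_space n (2 * n + 1 - k)"
proof -
  have k: "k \<le> n" using assms(2) by simp
  \<comment> \<open>The functional attached to a triple reads the coefficient at the leading
    monomial of its element; the weight \<open>w\<close> below is the index sum of that monomial's
    tableau part.\<close>
  define \<phi> where "\<phi> = (\<lambda>(I, J, R :: tableau) v. gcoeff v (xy_labels (set (fst R)) \<union> outer_labels I J))"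
  define w where "w = (\<lambda>(I :: nat set, J :: nat set, R :: tableau). \<Sum>(set (fst R)))"
  let ?X = "J_index n k"
  have lin: "linear (\<phi> i)" for i by (cases i) (simp add: \<phi>_def linear_gcoeff)
  have diag: "\<phi> i (J_element i) \<noteq> 0" if "i \<in> ?X" for i
  proof -
    obtain I J R where i: "i = (I, J, R)" by (cases i)
    note IJR = J_indexE[OF that[unfolded i] k]
    obtain c where "c \<noteq> 0" "J_element i = c *\<^sub>R (alpha R * gmonom (outer_labels I J))"
      using J_element_eq[OF IJR(1,2)] i by metis
    then show ?thesis
      using leads_J_index[OF that[unfolded i] k] by (simp add: i \<phi>_def leads_def)
  qed
  have tri: "w i < w j" if ij: "i \<in> ?X" "j \<in> ?X" "i \<noteq> j" "\<phi> j (J_element i) \<noteq> 0" for i j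
  proof -
    obtain I J R where i: "i = (I, J, R)" by (cases i)
    obtain I' J' R' where j: "j = (I', J', R')" by (cases j)
    note IJR = J_indexE[OF ij(1)[unfolded i] k] and IJR' = J_indexE[OF ij(2)[unfolded j] k]
    obtain c where c: "J_element i = c *\<^sub>R (alpha R * gmonom (outer_labels I J))"
      using J_element_eq[OF IJR(1,2)] i by metis
    have "gcoeff (alpha R * gmonom (outer_labels I J))
        (xy_labels (set (fst R')) \<union> outer_labels I' J') \<noteq> 0"
      using ij(4) by (simp add: c j \<phi>_def)
    with leads_J_index[OF ij(1)[unfolded i] k] obtain K where K: "K \<subseteq> {1..n} - (I \<union> J)"
      "xy_labels (set (fst R')) \<union> outer_labels I' J' = xy_labels K \<union> outer_labels I J"
      "K = set (fst R) \<or> \<Sum>(set (fst R)) < \<Sum>K"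
      by (rule leadsD)
    have eq: "set (fst R') = K" "I' = I" "J' = J"
      using label_sets_eqD[OF K(2)] K(1) IJR(3) IJR'(3,8) by blast+
    \<comment> \<open>The sets \<open>I\<close>, \<open>J\<close> and the first row determine the
      second row as the complement, and increasing rows are determined by their sets.\<close>
    have "R = R'" if "set (fst R) = set (fst R')"
    proof -
      have snd: "set (snd Q) = M - set (fst Q)" if "young_tableau M Q" for M Q
        using that by (auto simp: young_tableau_def)
      have "set (snd R) = set (snd R')"
        using snd[OF IJR(6)] snd[OF IJR'(6)] that eq(2,3) by simp
      then show ?thesis
        using that IJR(7) IJR'(7) unfolding standard_tableau_def
        by (intro prod_eqI) (auto intro: strict_sorted_equal)
    qed
    then have "K \<noteq> set (fst R)" using ij(3) eq by (auto simp: i j)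
    then show ?thesis using K(3) eq by (simp add: i j w_def)
  qed
  note fam = finite_J_index lin diag tri
  have sub: "span (J_element ` ?X) \<subseteq> J_space n (2 * n + 1 - k)"
    using J_element_in_J_space[OF _ k] by (intro span_minimal subspace_J_space) auto
  have "v \<in> span (J_element ` ?X)" if v: "v \<in> J_space n (2 * n + 1 - k)" for v
  proof -
    obtain u where u: "u \<in> span (J_element ` ?X)" "\<And>i. i \<in> ?X \<Longrightarrow> \<phi> i (v - u) = 0"
      using ex_span_triangular[of ?X \<phi> J_element w v] fam by blast
    \<comment> \<open>The remainder lies in \<open>J_space\<close> and vanishes at every leading
      monomial.\<close>
    have "v - u = 0"
    proof (rule J_space_eq_0[OF k])
      show "v - u \<in> J_space n (2 * n + 1 - k)"
        using v u(1) sub subspace_J_space by (blast intro: subspace_diff)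
    qed (use u(2) in \<open>force simp: \<phi>_def\<close>)
    then show ?thesis using u(1) by simp
  qed
  moreover have "inj_on J_element ?X"
    by (rule inj_on_triangular[of ?X \<phi> J_element w]) (use fam in auto)
  moreover have "independent (J_element ` ?X)"
    by (rule independent_triangular[of ?X \<phi> J_element w]) (use fam in auto)
  ultimately show ?thesis using sub by blast
qed

end
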